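(* Let $\Omega_1\subset\mathbb{C}^n$ and $\Omega_2\subset\mathbb{C}^m$ be bounded domains, and suppose that there exists an isomorphism of semigroups $\varphi: E(\Omega_1)\rightarrow E(\Omega_2)$. Then $n=m$ and there exists a map $\psi:\Omega_1\rightarrow\Omega_2$ which is biholomorphic or antibiholomorphic and such that $$\varphi f=\psi\circ f\circ\psi^{-1}\quad\text{for all } f\in E(\Omega_1).$$
   Context: For a bounded domain $\Omega$ in $\mathbb{C}^n$, $E(\Omega)$ denotes the semigroup, under composition, of all analytic (holomorphic) endomorphisms of $\Omega$, i.e. of all holomorphic maps $f:\Omega\to\Omega$. An isomorphism of semigroups is a bijective map preserving the semigroup operation; no continuity is assumed. We write $\varphi f$ for $\varphi(f)$. A map is antibiholomorphic if it is a bijection which is antiholomorphic (its complex conjugate, taken componentwise, is holomorphic) with antiholomorphic inverse. *)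

theory Defs
  imports "HOL-Analysis.Analysis" "HOL-Algebra.Group"
begin

definition bounded_domain :: "(complex ^ 'n) set \<Rightarrow> bool" where
  "bounded_domain \<Omega> \<longleftrightarrow> open \<Omega> \<and> connected \<Omega> \<and> \<Omega> \<noteq> {} \<and> bounded \<Omega>"

(* Frechet differentiable with complex-linear derivative. The library's holomorphic_on
   is confined to functions of one complex variable. Only used for open sets. *)
definition holomorphic_map_on :: "(complex ^ 'n \<Rightarrow> complex ^ 'm) \<Rightarrow> (complex ^ 'n) set \<Rightarrow> bool" where
  "holomorphic_map_on f \<Omega> \<longleftrightarrow>
     (\<forall>z\<in>\<Omega>. \<exists>L. Vector_Spaces.linear (*s) (*s) L \<and> (f has_derivative L) (at z within \<Omega>))"

definition vec_cnj :: "complex ^ 'n \<Rightarrow> complex ^ 'n" where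
  "vec_cnj v = (\<chi> i. cnj (v $ i))"

definition antiholomorphic_map_on :: "(complex ^ 'n \<Rightarrow> complex ^ 'm) \<Rightarrow> (complex ^ 'n) set \<Rightarrow> bool" where
  "antiholomorphic_map_on f \<Omega> \<longleftrightarrow> holomorphic_map_on (vec_cnj \<circ> f) \<Omega>"

definition biholomorphic_map ::
    "(complex ^ 'n) set \<Rightarrow> (complex ^ 'm) set \<Rightarrow> (complex ^ 'n \<Rightarrow> complex ^ 'm) \<Rightarrow> bool" where
  "biholomorphic_map \<Omega>1 \<Omega>2 \<psi> \<longleftrightarrow>
     bij_betw \<psi> \<Omega>1 \<Omega>2 \<and> holomorphic_map_on \<psi> \<Omega>1 \<and>
     holomorphic_map_on (inv_into \<Omega>1 \<psi>) \<Omega>2"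

definition antibiholomorphic_map ::
    "(complex ^ 'n) set \<Rightarrow> (complex ^ 'm) set \<Rightarrow> (complex ^ 'n \<Rightarrow> complex ^ 'm) \<Rightarrow> bool" where
  "antibiholomorphic_map \<Omega>1 \<Omega>2 \<psi> \<longleftrightarrow>
     bij_betw \<psi> \<Omega>1 \<Omega>2 \<and> antiholomorphic_map_on \<psi> \<Omega>1 \<and>
     antiholomorphic_map_on (inv_into \<Omega>1 \<psi>) \<Omega>2"

(* Endomorphisms are extensional functions (undefined outside \<Omega>), so that equality of
   elements is equality of maps on \<Omega>. The unit is recorded only to use the library's
   records; hom and iso refer to the multiplication alone, so iso is semigroup isomorphism. *)
definition endo_semigroup :: "(complex ^ 'n) set \<Rightarrow> (complex ^ 'n \<Rightarrow> complex ^ 'n) monoid" where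
  "endo_semigroup \<Omega> =
     \<lparr>carrier = {f \<in> \<Omega> \<rightarrow>\<^sub>E \<Omega>. holomorphic_map_on f \<Omega>},
      mult = compose \<Omega>,
      one = (\<lambda>z\<in>\<Omega>. z)\<rparr>"

end

theory Submission
  imports Defs "HOL-Complex_Analysis.Cauchy_Integral_Formula"
begin

text \<open>
  Constant maps are exactly the left zeros of the semigroup of endomorphisms. So an isomorphism
  \<open>\<phi>\<close> induces a bijection \<open>\<psi>\<close> of points, and evaluating products with constants shows that \<open>\<phi>\<close> is
  conjugation by \<open>\<psi>\<close> (\<open>iso_endo_semigroup_is_conjugation\<close>). What has to be shown is that a bijection
  which conjugates holomorphic endomorphisms into holomorphic endomorphisms, in both directions,
  is itself biholomorphic or antibiholomorphic. Bounded domains have many endomorphisms for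
  this purpose, in particular all affine maps with a sufficiently small linear part that send
  some point well inside the domain.

  Topology: the images of injective endomorphisms are open by invariance of domain, and
  contractions provide arbitrarily small ones around each point. Hence \<open>\<psi>\<close> is a homeomorphism,
  and the dimensions agree.

  Differentiability: conjugating the contractions \<open>z \<mapsto> p + v + \<epsilon> (z - p)\<close> by \<open>\<psi>\<close> gives a family of
  holomorphic maps \<open>G v\<close>, continuous in \<open>v\<close>. Averaging the relation
  \<open>G v (\<psi> z) = \<psi> (p + v + \<epsilon> (z - p))\<close> over \<open>v\<close> with a \<open>C\<^sup>1\<close> weight gives \<open>F (\<psi> z) = H z\<close>, where \<open>F\<close>
  inherits differentiability from the holomorphic maps \<open>G v\<close> and \<open>H\<close>, a mollification of \<open>\<psi>\<close>, is
  differentiable too. By Sard's theorem the derivative of \<open>G 0\<close> is invertible somewhere, and so is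
  that of \<open>F\<close> if the weight is concentrated near \<open>0\<close>. So \<open>\<psi>\<close> is real differentiable at some point
  (\<open>differentiable_somewhere\<close>), and then at every point, because contractions can map any point to
  any other one (\<open>derivative_transport\<close>).

  Complex structure: the derivative of \<open>\<psi>\<close> at a point conjugates complex linear maps into
  complex linear maps, in both directions. Such a real isomorphism is complex linear or
  conjugate linear (\<open>clinear_or_conjugate_linear_if_conjugates_clinear\<close>), and the type does not
  depend on the point, again by transport.
\<close>

section \<open>Complex linear maps\<close>

lemma clinear_iff:
  "Vector_Spaces.linear (*s) (*s) L \<longleftrightarrow>
     (\<forall>x y. L (x + y) = L x + L y) \<and> (\<forall>c x. L (c *s x) = c *s L x)"
  for L :: "complex ^ 'n \<Rightarrow> complex ^ 'm"
  by (simp add: Vector_Spaces.linear_iff vec.vector_space_axioms)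

lemma scaleR_eq_smult: "r *\<^sub>R x = complex_of_real r *s x"
  for x :: "complex ^ 'n"
  by (simp add: vec_eq_iff scaleR_conv_of_real[where 'a=complex])

lemma clinear_imp_linear:
  "Vector_Spaces.linear (*s) (*s) L \<Longrightarrow> linear L" for L :: "complex ^ 'n \<Rightarrow> complex ^ 'm"
  by (simp add: clinear_iff linear_iff scaleR_eq_smult)

lemma clinear_scaleR:
  "Vector_Spaces.linear (*s) (*s) A \<Longrightarrow> Vector_Spaces.linear (*s) (*s) (\<lambda>x. r *\<^sub>R A x)"
  for A :: "complex ^ 'n \<Rightarrow> complex ^ 'm"
  by (simp add: clinear_iff scaleR_eq_smult vector_add_ldistrib vector_smult_assoc mult.commute)

lemma clinear_id: "Vector_Spaces.linear (*s) (*s) (\<lambda>x :: complex ^ 'n. x)"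
  by (simp add: clinear_iff)

lemma norm_smult: "norm (c *s x) = cmod c * norm x" for x :: "complex ^ 'n"
  by (simp add: norm_vec_def norm_mult L2_set_right_distrib)

text \<open>
  This decides between the holomorphic and the antiholomorphic case. Multiplication by \<open>\<i>\<close>,
  transported by the real isomorphism \<open>L\<close>, becomes a complex linear map \<open>J\<close> with \<open>J\<^sup>2 = -1\<close>.
  Because conjugation by \<open>L\<close> respects complex linearity in both directions, \<open>J\<close> commutes with
  every complex linear map, so it is a scalar, and the only scalars with square \<open>-1\<close> are
  \<open>\<i>\<close> and \<open>-\<i>\<close>.
\<close>

lemma clinear_or_conjugate_linear_if_conjugates_clinear:
  fixes L :: "complex ^ 'n \<Rightarrow> complex ^ 'm" and M :: "complex ^ 'm \<Rightarrow> complex ^ 'n"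
  assumes lin: "linear L" "linear M" and inv: "\<And>x. M (L x) = x" "\<And>y. L (M y) = y"
    and LAM: "\<And>A :: complex ^ 'n \<Rightarrow> complex ^ 'n. Vector_Spaces.linear (*s) (*s) A \<Longrightarrow>
        Vector_Spaces.linear (*s) (*s) (\<lambda>y. L (A (M y)))"
    and MBL: "\<And>B :: complex ^ 'm \<Rightarrow> complex ^ 'm. Vector_Spaces.linear (*s) (*s) B \<Longrightarrow>
        Vector_Spaces.linear (*s) (*s) (\<lambda>x. M (B (L x)))"
  shows "(\<forall>c x. L (c *s x) = c *s L x) \<or> (\<forall>c x. L (c *s x) = cnj c *s L x)"
proof -
  define J where "J = (\<lambda>y. L (\<i> *s M y))"
  have commutes: "B (J y) = J (B y)" if "Vector_Spaces.linear (*s) (*s) B" for B y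
  proof -
    have "M (B (L (\<i> *s M y))) = \<i> *s M (B (L (M y)))"
      using MBL[OF that] by (simp add: clinear_iff)
    then show ?thesis
      by (metis J_def inv)
  qed
  fix k :: 'm
  define c where "c = J (axis k 1) $ k"
  have J_scalar: "J v = c *s v" for v
  proof -
    \<comment> \<open>Maps of rank one suffice: this one sends the \<open>k\<close>-th basis vector to \<open>v\<close>.\<close>
    have "Vector_Spaces.linear (*s) (*s) (\<lambda>x :: complex ^ 'm. x $ k *s v)"
      by (simp add: clinear_iff vec_eq_iff algebra_simps)
    from commutes[OF this, of "axis k 1"] show ?thesis
      by (simp add: c_def)
  qed
  have J_smult: "L (\<i> *s x) = c *s L x" for x
    using J_scalar[of "L x"] by (simp add: J_def inv)
  let ?a = "axis undefined 1 :: complex ^ 'n"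
  have "\<i> *s (\<i> *s ?a) = - ?a"
    by (simp add: vec_eq_iff)
  then have "c *s (c *s L ?a) = - L ?a"
    using J_smult linear_neg[OF lin(1), of ?a] by metis
  then have "(c * c + 1) *s L ?a = 0"
    by (simp add: vector_sadd_rdistrib vector_smult_assoc)
  moreover have "L ?a \<noteq> 0"
    using inv(1)[of ?a] linear_0[OF lin(2)] by (auto simp: axis_eq_0_iff)
  ultimately have "c * c = - 1"
    using vec.scale_eq_0_iff by (metis eq_neg_iff_add_eq_0)
  then have "c\<^sup>2 = \<i>\<^sup>2" by (simp add: power2_eq_square)
  then have c: "c = \<i> \<or> c = - \<i>" by (simp only: power2_eq_iff)
  have L: "L (z *s x) = (of_real (Re z) + of_real (Im z) * c) *s L x" for z x
  proof -
    have "z *s x = Re z *\<^sub>R x + Im z *\<^sub>R (\<i> *s x)"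
      by (simp add: vec_eq_iff complex_eq_iff algebra_simps)
    then have "L (z *s x) = Re z *\<^sub>R L x + Im z *\<^sub>R (c *s L x)"
      by (simp add: linear_add[OF lin(1)] linear_scale[OF lin(1)] J_smult)
    then show ?thesis
      by (simp add: scaleR_eq_smult vector_sadd_rdistrib vector_smult_assoc)
  qed
  from c show ?thesis
  proof
    assume "c = \<i>"
    then have "of_real (Re z) + of_real (Im z) * c = z" for z
      by (simp add: complex_eq_iff)
    with L show ?thesis by simp
  next
    assume "c = - \<i>"
    then have "of_real (Re z) + of_real (Im z) * c = cnj z" for z
      by (simp add: complex_eq_iff)
    with L show ?thesis by simp
  qed
qed

section \<open>Holomorphic maps of several variables\<close>

lemma holomorphic_map_on_open:
  "open \<Omega> \<Longrightarrow> holomorphic_map_on f \<Omega> \<longleftrightarrow>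
    (\<forall>z\<in>\<Omega>. \<exists>L. Vector_Spaces.linear (*s) (*s) L \<and> (f has_derivative L) (at z))"
  unfolding holomorphic_map_on_def by (rule ball_cong) (simp_all only: at_within_open)

lemma holomorphic_map_onD:
  assumes "holomorphic_map_on f \<Omega>" "open \<Omega>" "z \<in> \<Omega>" "(f has_derivative D) (at z)"
  shows "Vector_Spaces.linear (*s) (*s) D"
  using assms has_derivative_unique by (metis holomorphic_map_on_open)

lemma holomorphic_map_on_differentiable:
  assumes "holomorphic_map_on f \<Omega>" "open \<Omega>" "z \<in> \<Omega>"
  shows "f differentiable (at z)"
  using assms by (metis holomorphic_map_on_open differentiable_def)

lemma holomorphic_map_on_continuous:
  "holomorphic_map_on f \<Omega> \<Longrightarrow> continuous_on \<Omega> f"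
  by (metis holomorphic_map_on_def has_derivative_continuous continuous_on_eq_continuous_within)

lemma holomorphic_map_on_cong:
  assumes "\<And>z. z \<in> \<Omega> \<Longrightarrow> f z = g z"
  shows "holomorphic_map_on f \<Omega> \<longleftrightarrow> holomorphic_map_on g \<Omega>"
proof -
  have "holomorphic_map_on g' \<Omega>"
    if "holomorphic_map_on f' \<Omega>" "\<And>z. z \<in> \<Omega> \<Longrightarrow> f' z = g' z" for f' g'
    unfolding holomorphic_map_on_def
    by (metis that holomorphic_map_on_def has_derivative_transform)
  then show ?thesis using assms by metis
qed

lemma holomorphic_map_on_affine: "holomorphic_map_on (\<lambda>z. a + A (z - p)) \<Omega>"
  if A: "Vector_Spaces.linear (*s) (*s) A" for A :: "complex ^ 'n \<Rightarrow> complex ^ 'm"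
proof -
  have "((\<lambda>z. a + A (z - p)) has_derivative A) (at z within \<Omega>)" for z
    using linear_conv_bounded_linear[THEN iffD1, OF clinear_imp_linear[OF A]]
    by (auto intro!: derivative_eq_intros bounded_linear.has_derivative[of A])
  then show ?thesis using A by (auto simp: holomorphic_map_on_def)
qed

text \<open>
  On the complex line through \<open>w\<close> in the direction of \<open>k\<close>, every component of \<open>h\<close> is a holomorphic
  function of one variable, so the estimate reduces to Cauchy's inequality. The constant is
  not optimal: circles of radius \<open>r / 2\<close> are used in order to stay inside the open ball, and the
  norm is estimated by the sum of the components.
\<close>

lemma derivative_bound_Cauchy:
  fixes h :: "complex ^ 'n \<Rightarrow> complex ^ 'm" and B :: real
  assumes hol: "holomorphic_map_on h (ball w r)" and r: "0 < r"
    and D: "(h has_derivative D) (at w)"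
    and bound: "\<And>x. x \<in> ball w r \<Longrightarrow> norm (h x) \<le> B"
  shows "norm (D k) \<le> 2 * CARD('m) * B / r * norm k"
proof (cases "k = 0")
  case True
  then show ?thesis using D by (simp add: has_derivative_def bounded_linear.linear linear_0)
next
  case False
  define e where "e = (1 / norm k) *\<^sub>R k"
  have e: "norm e = 1" and k: "k = norm k *\<^sub>R e" using False by (auto simp: e_def)
  have in_ball: "w + \<zeta> *s e \<in> ball w r" if "cmod \<zeta> < r" for \<zeta>
    using that e by (simp add: dist_norm norm_smult)
  have "bounded_linear (\<lambda>\<zeta>. \<zeta> *s e)"
    by (intro linear_conv_bounded_linear[THEN iffD1] linearI)
       (simp_all add: vector_sadd_rdistrib scaleR_eq_smult vector_smult_assoc scaleR_conv_of_real)
  then have line: "((\<lambda>\<zeta>. w + \<zeta> *s e) has_derivative (\<lambda>\<zeta>. \<zeta> *s e)) F" for F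
    using has_derivative_add[OF has_derivative_const bounded_linear_imp_has_derivative] by fastforce
  have slice: "((\<lambda>\<zeta>. h (w + \<zeta> *s e) $ j) has_field_derivative L e $ j) (at \<zeta>)"
    if L: "(h has_derivative L) (at (w + \<zeta> *s e))" and \<zeta>: "cmod \<zeta> < r" for L \<zeta> j
  proof -
    have lin: "Vector_Spaces.linear (*s) (*s) L"
      using holomorphic_map_onD[OF hol _ in_ball[OF \<zeta>] L] by simp
    have "((\<lambda>\<zeta>. h (w + \<zeta> *s e) $ j) has_derivative (\<lambda>t. L (t *s e) $ j)) (at \<zeta>)"
      by (rule bounded_linear.has_derivative[OF bounded_linear_vec_nth])
         (rule has_derivative_compose[OF line L])
    moreover have "(\<lambda>t. L (t *s e) $ j) = (*) (L e $ j)"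
      using lin by (simp add: fun_eq_iff clinear_iff mult.commute)
    ultimately show ?thesis
      by (simp add: has_field_derivative_def)
  qed
  have comp: "cmod (D e $ j) \<le> 2 * B / r" for j
  proof -
    let ?q = "\<lambda>\<zeta>. h (w + \<zeta> *s e) $ j"
    have diff: "\<exists>d. (?q has_field_derivative d) (at \<zeta>)" if \<zeta>: "cmod \<zeta> < r" for \<zeta>
    proof -
      obtain L where "(h has_derivative L) (at (w + \<zeta> *s e))"
        using hol in_ball[OF \<zeta>] unfolding holomorphic_map_on_open[OF open_ball] by blast
      then show ?thesis using slice \<zeta> by blast
    qed
    then have q: "?q holomorphic_on ball 0 r"
      by (simp add: holomorphic_on_open)
    have 1: "?q holomorphic_on ball 0 (r/2)"
      by (rule holomorphic_on_subset[OF q]) (use r in auto)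
    have 3: "continuous_on (cball 0 (r/2)) ?q"
      by (rule holomorphic_on_imp_continuous_on, rule holomorphic_on_subset[OF q]) (use r in auto)
    have 2: "cmod (?q x) \<le> B" if "norm (0 - x) = r/2" for x
    proof -
      have "cmod (?q x) \<le> norm (h (w + x *s e))" by (rule Finite_Cartesian_Product.norm_nth_le)
      also have "\<dots> \<le> B" using bound in_ball that r by simp
      finally show ?thesis .
    qed
    have "cmod (deriv ?q 0) \<le> B / (r/2)"
      using Cauchy_inequality[OF 1 3 _ 2, of 1] r by simp
    moreover have "deriv ?q 0 = D e $ j"
      using slice[of D 0 j] D r by (simp add: DERIV_imp_deriv)
    ultimately show ?thesis by (simp add: mult.commute)
  qed
  have "norm (D e) \<le> (\<Sum>j\<in>UNIV. cmod (D e $ j))"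
    by (simp add: norm_vec_def L2_set_le_sum)
  also have "\<dots> \<le> CARD('m) * (2 * B / r)"
    using sum_bounded_above[of UNIV "\<lambda>j. cmod (D e $ j)", OF comp] by simp
  finally have "norm (D e) \<le> CARD('m) * (2 * B / r)" .
  from mult_right_mono[OF this norm_ge_zero[of k]]
  have "norm (D e) * norm k \<le> 2 * CARD('m) * B / r * norm k"
    by (simp add: mult_ac)
  moreover have "norm (D k) = norm k * norm (D e)"
    using D by (subst k) (simp add: has_derivative_def bounded_linear.linear linear_scale)
  ultimately show ?thesis by (simp add: mult.commute)
qed

text \<open>
  Sard's theorem: if the derivative were singular everywhere, the image would be a null set.
  Coordinates are taken in \<open>real ^ 'n bit0\<close>, because \<open>'n bit0\<close> is a well-ordered index type with
  twice as many elements as \<open>'n\<close>, the real dimension of \<open>complex ^ 'n\<close>.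
\<close>

lemma injective_derivative_if_open_image:
  fixes g :: "complex ^ 'n \<Rightarrow> complex ^ 'n"
  assumes der: "\<And>x. x \<in> S \<Longrightarrow> (g has_derivative g' x) (at x)"
    and "open (g ` S)" "S \<noteq> {}"
  obtains x where "x \<in> S" "inj (g' x)"
proof -
  have "DIM(complex ^ 'n) = DIM(real ^ 'n bit0)" by simp
  then obtain J :: "complex ^ 'n \<Rightarrow> real ^ 'n bit0" and K
    where J: "linear J" and K: "linear K" and KJ: "\<And>x. K (J x) = x" and JK: "\<And>y. J (K y) = y"
    using isomorphisms_UNIV_UNIV by metis
  note bl = J[unfolded linear_conv_bounded_linear] K[unfolded linear_conv_bounded_linear]
  let ?k' = "\<lambda>y h. J (g' (K y) (K h))"
  have "\<exists>x\<in>S. inj (g' x)"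
  proof (rule ccontr)
    assume noninj: "\<not> (\<exists>x\<in>S. inj (g' x))"
    have k': "((\<lambda>y. J (g (K y))) has_derivative ?k' y) (at y within J ` S)" if "y \<in> J ` S" for y
    proof -
      have "(g has_derivative g' (K y)) (at (K y))" using that der KJ by auto
      then have "((\<lambda>y. g (K y)) has_derivative (\<lambda>h. g' (K y) (K h))) (at y within J ` S)"
        by (rule has_derivative_compose[OF bounded_linear_imp_has_derivative[OF bl(2)]])
      then show ?thesis by (rule bounded_linear.has_derivative[OF bl(1)])
    qed
    have rank: "rank (matrix (?k' y)) < CARD('n bit0)" if y: "y \<in> J ` S" for y
    proof -
      have "linear (?k' y)" using k'[OF y] by (rule has_derivative_linear)
      then have "(*v) (matrix (?k' y)) = ?k' y" by (simp add: fun_eq_iff matrix_works)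
      moreover have "\<not> inj (?k' y)"
      proof
        assume inj: "inj (?k' y)"
        have "inj (g' (K y))"
        proof (rule injI)
          fix u v assume "g' (K y) u = g' (K y) v"
          then have "?k' y (J u) = ?k' y (J v)" by (simp add: KJ)
          with inj have "J u = J v" by (rule injD)
          then show "u = v" by (metis KJ)
        qed
        then show False using noninj y KJ by auto
      qed
      ultimately show ?thesis unfolding less_rank_noninjective by metis
    qed
    have "negligible ((\<lambda>y. J (g (K y))) ` J ` S)"
      by (rule baby_Sard[where f' = ?k', OF order_refl]) (erule k', erule rank)
    moreover have "(\<lambda>y. J (g (K y))) ` J ` S = J ` g ` S"
      by (simp add: image_image KJ)
    moreover have "open (J ` g ` S)"
      using assms(2) J by (rule open_surjective_linear_image) (metis JK surjI)
    ultimately show False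
      using open_not_negligible \<open>S \<noteq> {}\<close> by (metis image_is_empty)
  qed
  then show thesis using that by blast
qed

text \<open>
  Uniform closeness of holomorphic maps controls their derivatives by the Cauchy estimate.
  Compactness of the parameter set gives uniform closeness of \<open>G v (w + u)\<close> and \<open>G v1 (w1 + u)\<close>
  for all small \<open>u\<close>.
\<close>

lemma continuous_on_derivative_of_holomorphic_family:
  fixes G :: "'v::metric_space \<Rightarrow> complex ^ 'n \<Rightarrow> complex ^ 'm"
  assumes \<Omega>: "open \<Omega>" and V: "compact V"
    and hol: "\<And>v. v \<in> V \<Longrightarrow> holomorphic_map_on (G v) \<Omega>"
    and cont: "continuous_on (V \<times> \<Omega>) (\<lambda>(v, w). G v w)"
    and DG: "\<And>v w. v \<in> V \<Longrightarrow> w \<in> \<Omega> \<Longrightarrow> (G v has_derivative blinfun_apply (DG v w)) (at w)"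
  shows "continuous_on (\<Omega> \<times> V) (\<lambda>(w, v). DG v w)"
proof -
  have "\<exists>d>0. \<forall>w\<in>\<Omega>. \<forall>v\<in>V. dist (w, v) (w1, v1) < d \<longrightarrow> dist (DG v w) (DG v1 w1) < e"
    if w1: "w1 \<in> \<Omega>" and v1: "v1 \<in> V" and e: "0 < e" for w1 v1 e
  proof -
    obtain r' where "r' > 0" "cball w1 r' \<subseteq> \<Omega>"
      using \<Omega> w1 open_contains_cball by blast
    then obtain r where r: "0 < r" and sub: "cball w1 (2 * r) \<subseteq> \<Omega>"
      by (metis half_gt_zero_iff field_sum_of_halves mult_2)
    define \<eta> where "\<eta> = e * r / (4 * CARD('m))"
    have \<eta>: "0 < \<eta>" using e r by (simp add: \<eta>_def)
    have "uniformly_continuous_on (V \<times> cball w1 (2 * r)) (\<lambda>(v, w). G v w)"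
      using sub by (intro compact_uniformly_continuous continuous_on_subset[OF cont] compact_Times V) auto
    then obtain d where d: "d > 0" and unif: "\<And>v w. v \<in> V \<Longrightarrow> w \<in> cball w1 (2 * r) \<Longrightarrow>
        \<forall>v'\<in>V. \<forall>w'\<in>cball w1 (2 * r). dist (v', w') (v, w) < d \<longrightarrow> dist (G v' w') (G v w) < \<eta>"
      unfolding uniformly_continuous_on_def using \<eta> by fastforce
    have "dist (DG v w) (DG v1 w1) < e"
      if w: "w \<in> \<Omega>" and v: "v \<in> V" and close: "dist (w, v) (w1, v1) < min d r" for w v
    proof -
      have "dist w w1 < r"
        using close dist_fst_le[of "(w, v)" "(w1, v1)"] by simp
      then have in_cball: "w + u \<in> cball w1 (2 * r)" "w1 + u \<in> cball w1 (2 * r)" if "u \<in> ball 0 r" for u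
        using that r norm_triangle_ineq[of "w - w1" u] by (auto simp: dist_norm norm_minus_commute algebra_simps)
      let ?h = "\<lambda>u. G v (w + u) - G v1 (w1 + u)"
      have dh: "(?h has_derivative blinfun_apply (DG v (w + u) - DG v1 (w1 + u))) (at u)"
        if "u \<in> ball 0 r" for u
      proof -
        have shift: "((\<lambda>u. x + u) has_derivative (\<lambda>h. h)) (at u)" for x :: "complex ^ 'n"
          by (auto intro!: derivative_eq_intros)
        have "((\<lambda>u. G v (w + u)) has_derivative blinfun_apply (DG v (w + u))) (at u)"
          using in_cball[OF that] sub v by (intro has_derivative_compose[OF shift] DG) auto
        moreover have "((\<lambda>u. G v1 (w1 + u)) has_derivative blinfun_apply (DG v1 (w1 + u))) (at u)"
          using in_cball[OF that] sub v1 by (intro has_derivative_compose[OF shift] DG) auto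
        ultimately show ?thesis
          unfolding minus_blinfun.rep_eq by (rule has_derivative_diff)
      qed
      have "holomorphic_map_on ?h (ball 0 r)"
        unfolding holomorphic_map_on_open[OF open_ball]
      proof
        fix u :: "complex ^ 'n" assume u: "u \<in> ball 0 r"
        have "Vector_Spaces.linear (*s) (*s) (blinfun_apply (DG v (w + u)))"
             "Vector_Spaces.linear (*s) (*s) (blinfun_apply (DG v1 (w1 + u)))"
          using in_cball[OF u] sub v v1 by (auto intro!: holomorphic_map_onD[OF hol \<Omega> _ DG])
        then have "Vector_Spaces.linear (*s) (*s) (blinfun_apply (DG v (w + u) - DG v1 (w1 + u)))"
          by (simp add: clinear_iff minus_blinfun.rep_eq vector_ssub_ldistrib)
        then show "\<exists>L. Vector_Spaces.linear (*s) (*s) L \<and> (?h has_derivative L) (at u)"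
          using dh[OF u] by blast
      qed
      moreover have "norm (?h u) \<le> \<eta>" if u: "u \<in> ball 0 r" for u
      proof -
        have "dist (v, w + u) (v1, w1 + u) = dist (w, v) (w1, v1)"
          by (simp add: dist_Pair_Pair add.commute)
        then have "dist (G v (w + u)) (G v1 (w1 + u)) < \<eta>"
          using unif[OF v1 in_cball(2)[OF u]] v in_cball(1)[OF u] close by auto
        then show ?thesis by (simp add: dist_norm)
      qed
      moreover have "(?h has_derivative blinfun_apply (DG v w - DG v1 w1)) (at 0)"
        using dh[of 0] r by simp
      ultimately have "norm (blinfun_apply (DG v w - DG v1 w1) k) \<le> 2 * CARD('m) * \<eta> / r * norm k" for k
        by (intro derivative_bound_Cauchy[OF _ r])
      then have "norm (DG v w - DG v1 w1) \<le> 2 * CARD('m) * \<eta> / r"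
        using r \<eta> by (intro norm_blinfun_bound) auto
      also have "\<dots> < e"
        using r e by (simp add: \<eta>_def)
      finally show ?thesis by (simp add: dist_norm)
    qed
    then show ?thesis
      using d r by (intro exI[of _ "min d r"]) auto
  qed
  then show ?thesis
    unfolding continuous_on_iff by fastforce
qed

section \<open>Smoothing by averages over translations\<close>

text \<open>A compactly supported weight that is just regular enough, namely \<open>C\<^sup>1\<close>.\<close>

definition bump :: "real \<Rightarrow> 'a::euclidean_space \<Rightarrow> real" where
  "bump \<delta> v = (max 0 (\<delta>\<^sup>2 - v \<bullet> v))\<^sup>2"

lemma bump_nonneg: "0 \<le> bump \<delta> v"
  by (simp add: bump_def)

lemma bump_zero_pos: "0 < \<delta> \<Longrightarrow> 0 < bump \<delta> 0"
  by (simp add: bump_def)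

lemma bump_eq_0: "0 < \<delta> \<Longrightarrow> \<delta> \<le> norm v \<Longrightarrow> bump \<delta> v = 0"
  using power_mono[of \<delta> "norm v" 2] by (simp add: bump_def power2_norm_eq_inner)

lemma continuous_on_bump [continuous_intros]:
  "continuous_on S f \<Longrightarrow> continuous_on S (\<lambda>x. bump \<delta> (f x))"
  unfolding bump_def by (intro continuous_intros)

text \<open>
  The remainder of the linear approximation is at most \<open>(y - t)\<^sup>2\<close> whatever the signs of \<open>y\<close> and
  \<open>t\<close>, which includes the point \<open>t = 0\<close> where the two branches meet.
\<close>

lemma DERIV_positive_part_power2:
  "((\<lambda>t. (max 0 t)\<^sup>2) has_real_derivative 2 * max 0 t) (at t)" for t :: real
proof -
  have "norm ((max 0 y)\<^sup>2 - (max 0 t)\<^sup>2 - (y - t) * (2 * max 0 t)) \<le> norm (y - t) * norm (y - t)" for y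
  proof -
    consider "y \<ge> 0" "t \<ge> 0" | "y \<ge> 0" "t < 0" | "y < 0" "t \<ge> 0" | "y < 0" "t < 0" by linarith
    then show ?thesis
    proof cases
      case 1
      then have "(max 0 y)\<^sup>2 - (max 0 t)\<^sup>2 - (y - t) * (2 * max 0 t) = (y - t) * (y - t)"
        by (simp add: max_def power2_eq_square algebra_simps)
      then show ?thesis by (simp add: abs_mult)
    next
      case 2
      then have "y * y \<le> (y - t) * (y - t)"
        by (intro mult_mono) auto
      then show ?thesis using 2
        by (simp add: max_def power2_eq_square abs_mult[symmetric])
    next
      case 3
      then have eq: "(max 0 y)\<^sup>2 - (max 0 t)\<^sup>2 - (y - t) * (2 * max 0 t) = t * t - 2 * y * t"
        by (simp add: max_def power2_eq_square algebra_simps)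
      have "0 \<le> t * (t - 2 * y)" using 3 by (intro mult_nonneg_nonneg) auto
      then have "0 \<le> t * t - 2 * y * t" by (simp add: algebra_simps)
      moreover have "t * t - 2 * y * t \<le> (y - t) * (y - t)" by (simp add: algebra_simps)
      ultimately show ?thesis unfolding eq by (simp add: abs_mult[symmetric])
    qed (simp add: max_def)
  qed
  then have "\<exists>d>0. \<forall>y. norm (y - t) < d \<longrightarrow>
      norm ((max 0 y)\<^sup>2 - (max 0 t)\<^sup>2 - 2 * max 0 t * (y - t)) \<le> e * norm (y - t)" if "e > 0" for e
    using that by (intro exI[of _ e]) (smt (verit) mult.commute mult_right_mono norm_ge_zero)
  then show ?thesis
    unfolding has_field_derivative_def has_derivative_at_alt
    by (simp add: bounded_linear_mult_right)
qed

lemma has_derivative_bump: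
  "(bump \<delta> has_derivative (\<lambda>h. - 4 * max 0 (\<delta>\<^sup>2 - v \<bullet> v) * (v \<bullet> h))) (at v)"
proof -
  have "((\<lambda>v. \<delta>\<^sup>2 - v \<bullet> v) has_derivative (\<lambda>h. - 2 * (v \<bullet> h))) (at v)"
    by (auto intro!: derivative_eq_intros simp: inner_commute)
  from has_derivative_compose[OF this DERIV_positive_part_power2[unfolded has_field_derivative_def]]
  show ?thesis
    unfolding bump_def by (simp add: mult.assoc mult.left_commute)
qed

text \<open>
  The translation acts on the weight, so the integral is differentiable although \<open>k\<close> is only
  continuous.
\<close>

lemma differentiable_integral_bump_translate:
  fixes k :: "'a::euclidean_space \<Rightarrow> 'b::euclidean_space"
  assumes k: "continuous_on (cbox a b) k"
  shows "(\<lambda>d. integral (cbox a b) (\<lambda>v. bump \<delta> (v - d) *\<^sub>R k v)) differentiable (at d\<^sub>0)"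
proof -
  define D where "D = (\<lambda>d v. (4 * max 0 (\<delta>\<^sup>2 - (v - d) \<bullet> (v - d))) *\<^sub>R
      (blinfun_scaleR_left (k v) o\<^sub>L blinfun_inner_right (v - d)))"
  have "((\<lambda>d. bump \<delta> (v - d) *\<^sub>R k v) has_derivative blinfun_apply (D d v)) (at d within UNIV)" for d v
  proof -
    have "((\<lambda>d. v - d) has_derivative (\<lambda>h. - h)) (at d)"
      by (auto intro!: derivative_eq_intros)
    from has_derivative_compose[OF this has_derivative_bump]
    have "((\<lambda>d. bump \<delta> (v - d)) has_derivative (\<lambda>h. 4 * max 0 (\<delta>\<^sup>2 - (v - d) \<bullet> (v - d)) * ((v - d) \<bullet> h))) (at d)"
      by simp
    from has_derivative_scaleR_left[OF this]
    show ?thesis by (simp add: D_def scaleR_blinfun.rep_eq)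
  qed
  moreover have "(\<lambda>v. bump \<delta> (v - d) *\<^sub>R k v) integrable_on cbox a b" for d
    by (intro integrable_continuous continuous_intros k)
  moreover have "continuous_on (UNIV \<times> cbox a b) (\<lambda>(d, v). D d v)"
  proof -
    have "continuous_on (UNIV \<times> cbox a b) (\<lambda>p. k (snd p))"
      by (rule continuous_on_compose2[OF k continuous_on_snd]) (auto intro: continuous_on_id)
    then have "continuous_on (UNIV \<times> cbox a b) (\<lambda>p. D (fst p) (snd p))"
      unfolding D_def
      by (intro continuous_intros bounded_linear.continuous_on[OF bounded_linear_blinfun_scaleR_left]
          bounded_linear.continuous_on[OF bounded_linear_blinfun_inner_right]
          bounded_bilinear.continuous_on[OF bounded_bilinear_blinfun_compose])
    then show ?thesis by (simp add: case_prod_beta)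
  qed
  ultimately have "((\<lambda>d. integral (cbox a b) (\<lambda>v. bump \<delta> (v - d) *\<^sub>R k v)) has_derivative
      integral (cbox a b) (D d\<^sub>0)) (at d\<^sub>0 within UNIV)"
    by (intro leibniz_rule) auto
  then show ?thesis by (auto simp: differentiable_def)
qed

text \<open>
  Moves the translation from the function to the weight. The domain of integration stays the
  same because the box contains the supports of both integrands: the weight lives on a ball of
  radius \<open>\<delta>\<close>, and the translation by \<open>d\<close> keeps it inside the ball of radius \<open>2 * \<delta>\<close>.
\<close>

lemma integral_bump_shift:
  fixes k :: "'a::euclidean_space \<Rightarrow> 'b::euclidean_space"
  assumes \<delta>: "0 < \<delta>" and sub: "ball 0 (2 * \<delta>) \<subseteq> cbox a b" and d: "norm d < \<delta>"
    and k: "continuous_on (cbox a b) k"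
  shows "integral (cbox a b) (\<lambda>v. bump \<delta> v *\<^sub>R k (v + d)) = integral (cbox a b) (\<lambda>v. bump \<delta> (v - d) *\<^sub>R k v)"
    (is "_ = ?I")
proof -
  have supp: "bump \<delta> v = 0" if "v \<notin> cbox a b \<or> v + d \<notin> cbox a b" for v
  proof (rule bump_eq_0[OF \<delta>], rule ccontr)
    assume "\<not> \<delta> \<le> norm v"
    then have "v \<in> ball 0 (2 * \<delta>)" "v + d \<in> ball 0 (2 * \<delta>)"
      using d \<delta> norm_triangle_ineq[of v d] by auto
    then show False using sub that by blast
  qed
  have "(\<lambda>v. bump \<delta> (v - d) *\<^sub>R k v) integrable_on cbox a b"
    by (intro integrable_continuous continuous_intros k)
  then have "((\<lambda>v. bump \<delta> (v - d) *\<^sub>R k v) has_integral ?I) (cbox a b)"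
    by (rule integrable_integral)
  from has_integral_affinity[OF this, of 1 d]
  have "((\<lambda>v. bump \<delta> v *\<^sub>R k (v + d)) has_integral ?I) ((\<lambda>x. x - d) ` cbox a b)"
    by simp
  then have "((\<lambda>v. bump \<delta> v *\<^sub>R k (v + d)) has_integral ?I) UNIV"
  proof (rule has_integral_on_superset)
    show "bump \<delta> v *\<^sub>R k (v + d) = 0" if "v \<notin> (\<lambda>x. x - d) ` cbox a b" for v
    proof -
      have "v + d \<notin> cbox a b" using that by (metis add_diff_cancel_right' image_eqI)
      then show ?thesis using supp by simp
    qed
  qed simp
  moreover have "(\<lambda>v. if v \<in> cbox a b then bump \<delta> v *\<^sub>R k (v + d) else 0) = (\<lambda>v. bump \<delta> v *\<^sub>R k (v + d))"
    using supp by auto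
  ultimately have "((\<lambda>v. bump \<delta> v *\<^sub>R k (v + d)) has_integral ?I) (cbox a b)"
    using has_integral_restrict_UNIV[of "cbox a b" "\<lambda>v. bump \<delta> v *\<^sub>R k (v + d)" ?I] by argo
  then show ?thesis by (rule integral_unique)
qed

text \<open>
  Since \<open>A\<close> is bounded below, increments of \<open>\<psi>\<close> are controlled by those of \<open>F \<circ> \<psi>\<close>. Hence \<open>\<psi>\<close> is
  Lipschitz at \<open>z\<close>, which turns the error term of \<open>F\<close> at \<open>\<psi> z\<close> into an error term at \<open>z\<close>.
\<close>

lemma differentiable_cancel_left:
  fixes F :: "'b::euclidean_space \<Rightarrow> 'c::euclidean_space" and \<psi> :: "'a::real_normed_vector \<Rightarrow> 'b"
  assumes F: "(F has_derivative A) (at (\<psi> z))" and A: "inj A"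
    and cont: "isCont \<psi> z" and H: "(\<lambda>x. F (\<psi> x)) differentiable (at z)"
  shows "\<psi> differentiable (at z)"
proof -
  obtain H' where H': "((\<lambda>x. F (\<psi> x)) has_derivative H') (at z)"
    using H by (auto simp: differentiable_def)
  have linA: "linear A" using F by (rule has_derivative_linear)
  obtain B where B: "linear B" and BA: "\<And>x. B (A x) = x"
    using linear_injective_left_inverse[OF linA A] by (auto simp: fun_eq_iff)
  have blB: "bounded_linear B" using B by (simp add: linear_conv_bounded_linear)
  obtain b where b: "b > 0" "\<And>x. norm (B x) \<le> norm x * b"
    using bounded_linear.pos_bounded[OF blB] by blast
  have blH: "bounded_linear H'" using H' by (rule has_derivative_bounded_linear)
  obtain h where h: "h > 0" "\<And>x. norm (H' x) \<le> norm x * h"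
    using bounded_linear.pos_bounded[OF blH] by blast
  define C where "C = 2 * b * (h + 1)"
  have C: "C > 0" using b h by (simp add: C_def)
  \<comment> \<open>The left inverse \<open>B\<close> turns two expansions of \<open>F (\<psi> y)\<close> into one of \<open>\<psi> y\<close> itself. It is applied twice:
    with crude constants for the Lipschitz bound \<open>C\<close>, then with fine ones for the derivative.\<close>
  have key: "norm (\<psi> y - \<psi> z - B (H' (y - z))) \<le> b * (s * norm (y - z) + t * norm (\<psi> y - \<psi> z))"
    if 1: "norm (F (\<psi> y) - F (\<psi> z) - H' (y - z)) \<le> s * norm (y - z)"
      and 2: "norm (F (\<psi> y) - F (\<psi> z) - A (\<psi> y - \<psi> z)) \<le> t * norm (\<psi> y - \<psi> z)" for y s t
  proof -
    let ?r = "(F (\<psi> y) - F (\<psi> z) - H' (y - z)) - (F (\<psi> y) - F (\<psi> z) - A (\<psi> y - \<psi> z))"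
    have "\<psi> y - \<psi> z - B (H' (y - z)) = B ?r"
      by (simp add: linear_diff[OF B] BA)
    also have "norm \<dots> \<le> norm ?r * b" by (rule b)
    also have "\<dots> \<le> (s * norm (y - z) + t * norm (\<psi> y - \<psi> z)) * b"
      using order_trans[OF norm_triangle_ineq4 add_mono[OF 1 2]] b(1) by (intro mult_right_mono) simp_all
    finally show ?thesis by (simp add: mult.commute)
  qed
  have expF: "\<exists>d>0. \<forall>y. norm (y - z) < d \<longrightarrow>
      norm (F (\<psi> y) - F (\<psi> z) - A (\<psi> y - \<psi> z)) \<le> t * norm (\<psi> y - \<psi> z)" if "t > 0" for t
  proof -
    obtain d1 where "d1 > 0" "\<And>w. norm (w - \<psi> z) < d1 \<Longrightarrow> norm (F w - F (\<psi> z) - A (w - \<psi> z)) \<le> t * norm (w - \<psi> z)"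
      using F \<open>t > 0\<close> unfolding has_derivative_at_alt by blast
    moreover obtain d where "d > 0" "\<And>y. norm (y - z) < d \<Longrightarrow> norm (\<psi> y - \<psi> z) < d1"
      using cont \<open>d1 > 0\<close> unfolding continuous_at_eps_delta dist_norm by blast
    ultimately show ?thesis by blast
  qed
  have expH: "\<exists>d>0. \<forall>y. norm (y - z) < d \<longrightarrow>
      norm (F (\<psi> y) - F (\<psi> z) - H' (y - z)) \<le> s * norm (y - z)" if "s > 0" for s
    using H' that unfolding has_derivative_at_alt by blast
  have "\<exists>d>0. \<forall>y. norm (y - z) < d \<longrightarrow> norm (\<psi> y - \<psi> z - B (H' (y - z))) \<le> e * norm (y - z)"
    if e: "e > 0" for e
  proof -
    define s where "s = e / (2 * b)"
    define t where "t = min (1 / (2 * b)) (e / (2 * b * C))"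
    have s: "s > 0" and t: "t > 0" using e b C by (auto simp: s_def t_def)
    obtain d1 where d1: "d1 > 0" "\<And>y. norm (y - z) < d1 \<Longrightarrow>
        norm (F (\<psi> y) - F (\<psi> z) - A (\<psi> y - \<psi> z)) \<le> t * norm (\<psi> y - \<psi> z)"
      using expF[OF t] by blast
    obtain d2 where d2: "d2 > 0" "\<And>y. norm (y - z) < d2 \<Longrightarrow>
        norm (F (\<psi> y) - F (\<psi> z) - H' (y - z)) \<le> s * norm (y - z)"
      using expH[OF s] by blast
    obtain d3 where d3: "d3 > 0" "\<And>y. norm (y - z) < d3 \<Longrightarrow>
        norm (F (\<psi> y) - F (\<psi> z) - H' (y - z)) \<le> 1 * norm (y - z)"
      using expH[of 1] by auto
    have "norm (\<psi> y - \<psi> z - B (H' (y - z))) \<le> e * norm (y - z)"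
      if y: "norm (y - z) < min d1 (min d2 d3)" for y
    proof -
      let ?\<Delta> = "norm (\<psi> y - \<psi> z)" and ?x = "norm (y - z)"
      have "?\<Delta> \<le> norm (\<psi> y - \<psi> z - B (H' (y - z))) + norm (B (H' (y - z)))"
        using norm_triangle_sub[of "\<psi> y - \<psi> z" "B (H' (y - z))"] by simp
      also have "norm (B (H' (y - z))) \<le> ?x * h * b"
        using order_trans[OF b(2) mult_right_mono[OF h(2)]] b(1) by simp
      also have "norm (\<psi> y - \<psi> z - B (H' (y - z))) \<le> b * (1 * ?x + t * ?\<Delta>)"
        using d3(2)[of y] d1(2)[of y] y by (intro key) auto
      also have "b * (1 * ?x + t * ?\<Delta>) \<le> b * ?x + ?\<Delta> / 2"
      proof -
        have "b * t \<le> b * (1 / (2 * b))" using b(1) by (intro mult_left_mono) (auto simp: t_def)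
        then have "b * t \<le> 1/2" using b(1) by simp
        then have "b * t * ?\<Delta> \<le> 1/2 * ?\<Delta>" by (intro mult_right_mono) auto
        then show ?thesis by (simp add: algebra_simps)
      qed
      finally have \<Delta>: "?\<Delta> \<le> C * ?x" by (simp add: C_def algebra_simps)
      have "norm (\<psi> y - \<psi> z - B (H' (y - z))) \<le> b * (s * ?x + t * ?\<Delta>)"
        using d2(2)[of y] d1(2)[of y] y by (intro key) auto
      also have "\<dots> \<le> b * (s * ?x + e / (2 * b * C) * (C * ?x))"
        using \<Delta> b(1) t by (intro mult_left_mono add_left_mono mult_mono) (auto simp: t_def)
      also have "\<dots> = e * ?x"
        using b(1) C by (simp add: s_def field_simps)
      finally show ?thesis .
    qed
    then show ?thesis
      using d1(1) d2(1) d3(1) by (intro exI[of _ "min d1 (min d2 d3)"]) auto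
  qed
  then have "(\<psi> has_derivative (\<lambda>x. B (H' x))) (at z)"
    unfolding has_derivative_at_alt using bounded_linear_compose[OF blB blH] by blast
  then show ?thesis by (auto simp: differentiable_def)
qed

section \<open>Conjugations between semigroups of endomorphisms\<close>

text \<open>
  Holomorphic endomorphisms without the convention about values outside \<open>\<Omega>\<close>, so that conjugates
  can be written as plain compositions.
\<close>

definition hol_endo :: "(complex ^ 'n) set \<Rightarrow> (complex ^ 'n \<Rightarrow> complex ^ 'n) \<Rightarrow> bool" where
  "hol_endo \<Omega> f \<longleftrightarrow> f ` \<Omega> \<subseteq> \<Omega> \<and> holomorphic_map_on f \<Omega>"

lemma hol_endo_cong:
  assumes "hol_endo \<Omega> g" "\<And>x. x \<in> \<Omega> \<Longrightarrow> f x = g x"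
  shows "hol_endo \<Omega> f"
  using assms holomorphic_map_on_cong[of \<Omega> f g] by (auto simp: hol_endo_def)

lemma hol_endo_compose:
  assumes "hol_endo \<Omega> f" "hol_endo \<Omega> g"
  shows "hol_endo \<Omega> (\<lambda>z. f (g z))"
proof -
  have sub: "f ` \<Omega> \<subseteq> \<Omega>" "g ` \<Omega> \<subseteq> \<Omega>" using assms by (simp_all add: hol_endo_def)
  have "\<exists>L. Vector_Spaces.linear (*s) (*s) L \<and> ((\<lambda>z. f (g z)) has_derivative L) (at z within \<Omega>)"
    if z: "z \<in> \<Omega>" for z
  proof -
    obtain A where A: "Vector_Spaces.linear (*s) (*s) A" "(g has_derivative A) (at z within \<Omega>)"
      using assms(2) z unfolding hol_endo_def holomorphic_map_on_def by blast
    obtain B where B: "Vector_Spaces.linear (*s) (*s) B" "(f has_derivative B) (at (g z) within \<Omega>)"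
      using assms(1) sub z unfolding hol_endo_def holomorphic_map_on_def by blast
    have "((\<lambda>z. f (g z)) has_derivative (\<lambda>h. B (A h))) (at z within \<Omega>)"
      by (rule has_derivative_in_compose[OF A(2) has_derivative_subset[OF B(2) sub(2)]])
    moreover have "Vector_Spaces.linear (*s) (*s) (\<lambda>h. B (A h))"
      using A(1) B(1) by (simp add: clinear_iff)
    ultimately show ?thesis by blast
  qed
  then show ?thesis
    using sub unfolding hol_endo_def holomorphic_map_on_def by blast
qed

text \<open>
  The supply of endomorphisms on which everything rests: as \<open>\<Omega>\<close> is bounded, small multiples of a
  complex linear map, followed by a translation that may still be varied a little, map \<open>\<Omega>\<close>
  into any prescribed open subset.
\<close>

lemma affine_hol_endo_into_open:
  fixes A :: "complex ^ 'n \<Rightarrow> complex ^ 'n"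
  assumes \<Omega>: "bounded \<Omega>" and U: "open U" "p \<in> U" "U \<subseteq> \<Omega>" and A: "Vector_Spaces.linear (*s) (*s) A"
  obtains \<epsilon> \<rho> :: real where "0 < \<epsilon>" "0 < \<rho>"
    "\<And>v z. norm v < \<rho> \<Longrightarrow> z \<in> \<Omega> \<Longrightarrow> p + v + \<epsilon> *\<^sub>R A (z - q) \<in> U"
    "\<And>v. norm v < \<rho> \<Longrightarrow> hol_endo \<Omega> (\<lambda>z. p + v + \<epsilon> *\<^sub>R A (z - q))"
proof -
  obtain \<rho> where \<rho>: "\<rho> > 0" "ball p \<rho> \<subseteq> U" using U open_contains_ball by blast
  have "bounded ((\<lambda>z. z - q) ` \<Omega>)"
    using \<Omega> by (rule bounded_translation_minus)
  then have "bounded (A ` (\<lambda>z. z - q) ` \<Omega>)"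
    by (rule bounded_linear_image) (use clinear_imp_linear[OF A] in \<open>simp add: linear_conv_bounded_linear\<close>)
  then obtain R where R: "R > 0" "\<And>z. z \<in> \<Omega> \<Longrightarrow> norm (A (z - q)) \<le> R"
    unfolding bounded_pos by auto
  define \<epsilon> where "\<epsilon> = \<rho> / (2 * R)"
  have \<epsilon>: "\<epsilon> > 0" using \<rho> R by (simp add: \<epsilon>_def)
  have in_U: "p + v + \<epsilon> *\<^sub>R A (z - q) \<in> U" if "norm v < \<rho> / 2" "z \<in> \<Omega>" for v z
  proof -
    have "\<epsilon> * norm (A (z - q)) \<le> \<epsilon> * R"
      using R(2)[OF that(2)] \<epsilon> by (intro mult_left_mono) auto
    then have "norm (\<epsilon> *\<^sub>R A (z - q)) \<le> \<rho> / 2"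
      using \<epsilon> R(1) \<rho>(1) by (simp add: \<epsilon>_def)
    then have "norm (v + \<epsilon> *\<^sub>R A (z - q)) < \<rho>"
      using norm_triangle_ineq[of v "\<epsilon> *\<^sub>R A (z - q)"] that(1) by linarith
    then have "p + v + \<epsilon> *\<^sub>R A (z - q) \<in> ball p \<rho>"
      using norm_minus_cancel[of "v + \<epsilon> *\<^sub>R A (z - q)"] by (simp add: dist_norm add.assoc)
    then show ?thesis using \<rho> by blast
  qed
  have lin: "Vector_Spaces.linear (*s) (*s) (\<lambda>x. \<epsilon> *\<^sub>R A x)"
    using A by (rule clinear_scaleR)
  have "hol_endo \<Omega> (\<lambda>z. p + v + \<epsilon> *\<^sub>R A (z - q))" if "norm v < \<rho> / 2" for v
    using in_U[OF that] U(3) holomorphic_map_on_affine[OF lin] unfolding hol_endo_def by blast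
  then show thesis using that[of \<epsilon> "\<rho> / 2"] \<epsilon> \<rho>(1) in_U by simp
qed

text \<open>
  Conjugation by \<open>\<psi>\<close> is assumed to preserve holomorphy of endomorphisms in both directions, with
  the inverse \<open>\<theta>\<close> as a parameter of its own. Everything is then symmetric in the two domains, and
  each result on \<open>\<psi>\<close> also applies to \<open>\<theta>\<close>.
\<close>

locale endo_conjugation =
  fixes \<Omega>1 :: "(complex ^ 'n) set" and \<Omega>2 :: "(complex ^ 'm) set"
    and \<psi> :: "complex ^ 'n \<Rightarrow> complex ^ 'm" and \<theta> :: "complex ^ 'm \<Rightarrow> complex ^ 'n"
  assumes dom1: "bounded_domain \<Omega>1" and dom2: "bounded_domain \<Omega>2"
    and \<psi>_in: "z \<in> \<Omega>1 \<Longrightarrow> \<psi> z \<in> \<Omega>2" and \<theta>_in: "w \<in> \<Omega>2 \<Longrightarrow> \<theta> w \<in> \<Omega>1"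
    and \<theta>_\<psi>: "z \<in> \<Omega>1 \<Longrightarrow> \<theta> (\<psi> z) = z" and \<psi>_\<theta>: "w \<in> \<Omega>2 \<Longrightarrow> \<psi> (\<theta> w) = w"
    and conj_hol_endo: "hol_endo \<Omega>1 f \<Longrightarrow> hol_endo \<Omega>2 (\<lambda>w. \<psi> (f (\<theta> w)))"
    and conj_hol_endo': "hol_endo \<Omega>2 g \<Longrightarrow> hol_endo \<Omega>1 (\<lambda>z. \<theta> (g (\<psi> z)))"
begin

lemma flip: "endo_conjugation \<Omega>2 \<Omega>1 \<theta> \<psi>"
  by unfold_locales
    (fact dom2 dom1 \<theta>_in \<psi>_in \<psi>_\<theta> \<theta>_\<psi> conj_hol_endo' conj_hol_endo | assumption)+

lemma opens: "open \<Omega>1" "open \<Omega>2" and bdds: "bounded \<Omega>1" "bounded \<Omega>2" and nonempty: "\<Omega>1 \<noteq> {}" "\<Omega>2 \<noteq> {}"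
  using dom1 dom2 by (auto simp: bounded_domain_def)

text \<open>
  A point \<open>x\<close> of the preimage of an open set \<open>B\<close> has a neighbourhood inside the preimage: an affine
  contraction towards \<open>\<psi> x\<close> maps \<open>\<Omega>2\<close> into \<open>B\<close>, and its conjugate is an injective holomorphic
  endomorphism of \<open>\<Omega>1\<close>, whose image is open by invariance of domain.
\<close>

lemma continuous: "continuous_on \<Omega>1 \<psi>"
proof -
  have "\<exists>A. open A \<and> A \<inter> \<Omega>1 = \<psi> -` B \<inter> \<Omega>1" if "open B" for B
  proof -
    have "open (\<psi> -` B \<inter> \<Omega>1)"
    proof (subst open_subopen, intro ballI)
      fix x assume x: "x \<in> \<psi> -` B \<inter> \<Omega>1"
      have U: "open (B \<inter> \<Omega>2)" "\<psi> x \<in> B \<inter> \<Omega>2" "B \<inter> \<Omega>2 \<subseteq> \<Omega>2"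
        using x \<psi>_in opens that by auto
      obtain \<epsilon> \<rho> where \<epsilon>: "0 < \<epsilon>" and \<rho>: "0 < \<rho>"
        and into: "\<And>v z. norm v < \<rho> \<Longrightarrow> z \<in> \<Omega>2 \<Longrightarrow> \<psi> x + v + \<epsilon> *\<^sub>R (z - \<psi> x) \<in> B \<inter> \<Omega>2"
        and endo: "\<And>v. norm v < \<rho> \<Longrightarrow> hol_endo \<Omega>2 (\<lambda>z. \<psi> x + v + \<epsilon> *\<^sub>R (z - \<psi> x))"
        by (rule affine_hol_endo_into_open[where q = "\<psi> x", OF bdds(2) U clinear_id]) blast
      define g where "g = (\<lambda>z. \<psi> x + \<epsilon> *\<^sub>R (z - \<psi> x))"
      have g: "hol_endo \<Omega>2 g" "\<And>z. z \<in> \<Omega>2 \<Longrightarrow> g z \<in> B \<inter> \<Omega>2"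
        using endo[of 0] into[of 0] \<rho> by (simp_all add: g_def)
      let ?k = "\<lambda>z. \<theta> (g (\<psi> z))"
      have "continuous_on \<Omega>1 ?k"
        using conj_hol_endo'[OF g(1)] by (simp add: hol_endo_def holomorphic_map_on_continuous)
      moreover have "inj_on ?k \<Omega>1"
      proof (rule inj_onI)
        fix u v assume uv: "u \<in> \<Omega>1" "v \<in> \<Omega>1" and "?k u = ?k v"
        then have "g (\<psi> u) = g (\<psi> v)" using g(2) \<psi>_in by (metis \<psi>_\<theta> IntD2)
        then have "\<psi> u = \<psi> v" using \<epsilon> by (simp add: g_def)
        then show "u = v" using uv by (metis \<theta>_\<psi>)
      qed
      ultimately have "open (?k ` \<Omega>1)"
        using opens(1) by (intro invariance_of_domain)
      moreover have "x \<in> ?k ` \<Omega>1"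
        using x \<theta>_\<psi> by (intro image_eqI[of _ _ x]) (auto simp: g_def)
      moreover have "?k ` \<Omega>1 \<subseteq> \<psi> -` B \<inter> \<Omega>1"
        using g(2) \<psi>_in \<theta>_in \<psi>_\<theta> by (auto simp: image_subset_iff)
      ultimately show "\<exists>T. open T \<and> x \<in> T \<and> T \<subseteq> \<psi> -` B \<inter> \<Omega>1" by blast
    qed
    then show ?thesis by (intro exI[of _ "\<psi> -` B \<inter> \<Omega>1"]) auto
  qed
  then show ?thesis unfolding continuous_on_open_invariant by blast
qed

lemma inj: "inj_on \<psi> \<Omega>1"
  by (rule inj_on_inverseI[of _ \<theta>]) (rule \<theta>_\<psi>)

lemma derivatives_inverse:
  assumes p: "p \<in> \<Omega>1" and L: "(\<psi> has_derivative L) (at p)" and M: "(\<theta> has_derivative M) (at (\<psi> p))"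
  shows "M (L x) = x"
proof -
  have "((\<lambda>z. \<theta> (\<psi> z)) has_derivative (\<lambda>h. M (L h))) (at p)"
    by (rule has_derivative_compose[OF L M])
  then have "((\<lambda>z. z) has_derivative (\<lambda>h. M (L h))) (at p)"
    by (rule has_derivative_transform_within_open[OF _ opens(1) p]) (rule \<theta>_\<psi>)
  from has_derivative_unique[OF this has_derivative_ident] show ?thesis
    by (metis (no_types))
qed

text \<open>
  A scaled copy of \<open>A\<close> around \<open>p\<close> is an endomorphism of \<open>\<Omega>1\<close> that fixes \<open>p\<close>; the map
  \<open>y \<mapsto> L (A (M y))\<close> is, up to the scale, the derivative of its holomorphic conjugate.
\<close>

lemma conjugate_clinear:
  assumes p: "p \<in> \<Omega>1" and L: "(\<psi> has_derivative L) (at p)" and M: "(\<theta> has_derivative M) (at (\<psi> p))"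
    and A: "Vector_Spaces.linear (*s) (*s) A"
  shows "Vector_Spaces.linear (*s) (*s) (\<lambda>y. L (A (M y)))"
proof -
  obtain \<epsilon> \<rho> where \<epsilon>: "0 < \<epsilon>" and \<rho>: "0 < \<rho>"
    and endo: "\<And>v. norm v < \<rho> \<Longrightarrow> hol_endo \<Omega>1 (\<lambda>z. p + v + \<epsilon> *\<^sub>R A (z - p))"
    by (rule affine_hol_endo_into_open[where q = p, OF bdds(1) opens(1) p order_refl A]) blast
  let ?f = "\<lambda>z. p + \<epsilon> *\<^sub>R A (z - p)"
  have linA: "linear A" using clinear_imp_linear[OF A] .
  have linL: "linear L" using L by (rule has_derivative_linear)
  have hol: "holomorphic_map_on (\<lambda>w. \<psi> (?f (\<theta> w))) \<Omega>2"
    using conj_hol_endo[OF endo[of 0]] \<rho> by (simp add: hol_endo_def)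
  have fp: "?f (\<theta> (\<psi> p)) = p"
    using p by (simp add: \<theta>_\<psi> linear_0[OF linA])
  have "((\<lambda>z. A (z - p)) has_derivative A) (at z)" for z
    by (rule bounded_linear.has_derivative[OF linA[unfolded linear_conv_bounded_linear]])
       (auto intro!: derivative_eq_intros)
  then have "(?f has_derivative (\<lambda>h. \<epsilon> *\<^sub>R A h)) (at (\<theta> (\<psi> p)))"
    by (auto intro!: derivative_eq_intros)
  from has_derivative_compose[OF M this]
  have "((\<lambda>w. ?f (\<theta> w)) has_derivative (\<lambda>h. \<epsilon> *\<^sub>R A (M h))) (at (\<psi> p))" .
  moreover have "(\<psi> has_derivative L) (at (?f (\<theta> (\<psi> p))))"
    unfolding fp by (rule L)
  ultimately have "((\<lambda>w. \<psi> (?f (\<theta> w))) has_derivative (\<lambda>h. L (\<epsilon> *\<^sub>R A (M h)))) (at (\<psi> p))"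
    by (rule has_derivative_compose)
  from holomorphic_map_onD[OF hol opens(2) \<psi>_in[OF p] this]
  have "Vector_Spaces.linear (*s) (*s) (\<lambda>h. \<epsilon> *\<^sub>R L (A (M h)))"
    by (simp add: linear_scale[OF linL])
  from clinear_scaleR[OF this, of "1 / \<epsilon>"] show ?thesis using \<epsilon> by simp
qed

text \<open>
  With an affine contraction \<open>g\<close> that maps \<open>p\<close> to \<open>q\<close>, the map \<open>\<psi>\<close> near \<open>q\<close> is the composition of
  \<open>g\<inverse>\<close>, of \<open>\<psi>\<close> near \<open>p\<close>, and of the holomorphic conjugate of \<open>g\<close>. So the regularity of \<open>\<psi>\<close> at one
  point spreads to all points.
\<close>

lemma derivative_transport:
  assumes p: "p \<in> \<Omega>1" and q: "q \<in> \<Omega>1" and L: "(\<psi> has_derivative L) (at p)"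
  obtains T and \<epsilon> :: real where "Vector_Spaces.linear (*s) (*s) T"
    "(\<psi> has_derivative (\<lambda>h. T (L (\<epsilon> *\<^sub>R h)))) (at q)"
proof -
  obtain \<epsilon> \<rho> where \<epsilon>: "0 < \<epsilon>" and \<rho>: "0 < \<rho>"
    and endo: "\<And>v. norm v < \<rho> \<Longrightarrow> hol_endo \<Omega>1 (\<lambda>z. q + v + \<epsilon> *\<^sub>R (z - p))"
    by (rule affine_hol_endo_into_open[where q = p, OF bdds(1) opens(1) q order_refl clinear_id]) blast
  let ?g = "\<lambda>z. q + \<epsilon> *\<^sub>R (z - p)" and ?g' = "\<lambda>y. p + (1 / \<epsilon>) *\<^sub>R (y - q)"
  have "holomorphic_map_on (\<lambda>w. \<psi> (?g (\<theta> w))) \<Omega>2"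
    using conj_hol_endo[OF endo[of 0]] \<rho> by (simp add: hol_endo_def)
  then obtain T where T: "Vector_Spaces.linear (*s) (*s) T"
      "((\<lambda>w. \<psi> (?g (\<theta> w))) has_derivative T) (at (\<psi> p))"
    using \<psi>_in[OF p] unfolding holomorphic_map_on_open[OF opens(2)] by blast
  have g': "(?g' has_derivative (\<lambda>h. (1 / \<epsilon>) *\<^sub>R h)) (at q)"
    by (auto intro!: derivative_eq_intros)
  have "((\<lambda>y. \<psi> (?g' y)) has_derivative (\<lambda>h. L ((1 / \<epsilon>) *\<^sub>R h))) (at q)"
    using L by (intro has_derivative_compose[OF g']) simp
  moreover have "((\<lambda>w. \<psi> (?g (\<theta> w))) has_derivative T) (at (\<psi> (?g' q)))"
    using T(2) by simp
  ultimately have "((\<lambda>y. \<psi> (?g (\<theta> (\<psi> (?g' y))))) has_derivative (\<lambda>h. T (L ((1 / \<epsilon>) *\<^sub>R h)))) (at q)"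
    by (rule has_derivative_compose)
  moreover have "open (?g' -` \<Omega>1)"
    by (intro open_vimage opens(1) continuous_intros)
  moreover have "q \<in> ?g' -` \<Omega>1" using p by simp
  moreover have "\<psi> (?g (\<theta> (\<psi> (?g' y)))) = \<psi> y" if "y \<in> ?g' -` \<Omega>1" for y
    using that \<epsilon> by (simp add: \<theta>_\<psi>)
  ultimately have "(\<psi> has_derivative (\<lambda>h. T (L ((1 / \<epsilon>) *\<^sub>R h)))) (at q)"
    by (rule has_derivative_transform_within_open)
  then show thesis using that T(1) by blast
qed

text \<open>
  The regularity of \<open>\<psi>\<close> comes from averaging. The conjugates
  \<open>G v w = \<psi> (p + v + \<epsilon> (\<theta> w - p))\<close> of affine contractions are holomorphic in \<open>w\<close>, so their
  weighted average \<open>F w\<close> over small \<open>v\<close> is differentiable. On the other hand \<open>F (\<psi> z)\<close> is an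
  average of \<open>\<psi>\<close> itself over a translate of the box that moves with \<open>z\<close>, hence differentiable
  in \<open>z\<close>. If the average runs over a small enough box, the derivative of \<open>F\<close> at \<open>w0\<close> is close to a
  multiple of that of \<open>G 0\<close>; the latter is injective for a suitable \<open>w0\<close> by Sard's theorem.
  Then \<open>F\<close> can be cancelled from \<open>F \<circ> \<psi>\<close>.
\<close>

lemma differentiable_somewhere: "\<exists>z\<in>\<Omega>1. \<psi> differentiable (at z)"
proof -
  obtain p where p: "p \<in> \<Omega>1" using nonempty by blast
  obtain \<epsilon> \<rho> where \<epsilon>: "0 < \<epsilon>" and \<rho>: "0 < \<rho>"
    and into: "\<And>v z. norm v < \<rho> \<Longrightarrow> z \<in> \<Omega>1 \<Longrightarrow> p + v + \<epsilon> *\<^sub>R (z - p) \<in> \<Omega>1"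
    and endo: "\<And>v. norm v < \<rho> \<Longrightarrow> hol_endo \<Omega>1 (\<lambda>z. p + v + \<epsilon> *\<^sub>R (z - p))"
    by (rule affine_hol_endo_into_open[where q = p, OF bdds(1) opens(1) p order_refl clinear_id]) blast
  define V where "V = cball (0 :: complex ^ 'n) (\<rho> / 2)"
  have V: "norm v < \<rho>" if "v \<in> V" for v using that \<rho> by (simp add: V_def)
  have V0: "0 \<in> V" using \<rho> by (simp add: V_def)
  define G where "G = (\<lambda>v w. \<psi> (p + v + \<epsilon> *\<^sub>R (\<theta> w - p)))"
  have G_hol: "holomorphic_map_on (G v) \<Omega>2" if "v \<in> V" for v
    using conj_hol_endo[OF endo[OF V[OF that]]] by (simp add: G_def hol_endo_def)
  have \<theta>_cont: "continuous_on \<Omega>2 \<theta>"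
    using endo_conjugation.continuous[OF flip] .
  have G_cont: "continuous_on (V \<times> \<Omega>2) (\<lambda>(v, w). G v w)"
  proof -
    have "continuous_on (V \<times> \<Omega>2) (\<lambda>x. \<theta> (snd x))"
      by (rule continuous_on_compose2[OF \<theta>_cont continuous_on_snd[OF continuous_on_id]]) auto
    then have "continuous_on (V \<times> \<Omega>2) (\<lambda>x. p + fst x + \<epsilon> *\<^sub>R (\<theta> (snd x) - p))"
      by (intro continuous_intros)
    then have "continuous_on (V \<times> \<Omega>2) (\<lambda>x. \<psi> (p + fst x + \<epsilon> *\<^sub>R (\<theta> (snd x) - p)))"
      by (rule continuous_on_compose2[OF continuous]) (use into V \<theta>_in in auto)
    then show ?thesis by (simp add: G_def case_prod_beta)
  qed
  define DG where "DG = (\<lambda>v w. Blinfun (frechet_derivative (G v) (at w)))"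
  have DG: "(G v has_derivative blinfun_apply (DG v w)) (at w)" if "v \<in> V" "w \<in> \<Omega>2" for v w
  proof -
    have "(G v has_derivative frechet_derivative (G v) (at w)) (at w)"
      using holomorphic_map_on_differentiable[OF G_hol[OF that(1)] opens(2) that(2)]
      by (simp add: frechet_derivative_works)
    then show ?thesis
      by (simp add: DG_def bounded_linear_Blinfun_apply has_derivative_bounded_linear)
  qed
  have DG_cont: "continuous_on (\<Omega>2 \<times> V) (\<lambda>(w, v). DG v w)"
    by (rule continuous_on_derivative_of_holomorphic_family[OF opens(2) _ G_hol G_cont DG])
       (simp add: V_def)
  have G0_inj: "inj_on (G 0) \<Omega>2"
  proof (rule inj_onI)
    fix u w assume uw: "u \<in> \<Omega>2" "w \<in> \<Omega>2" and "G 0 u = G 0 w"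
    then have "p + 0 + \<epsilon> *\<^sub>R (\<theta> u - p) = p + 0 + \<epsilon> *\<^sub>R (\<theta> w - p)"
      unfolding G_def by (intro inj_onD[OF inj]) (simp_all add: into \<rho> \<theta>_in del: add_0_right)
    then have "\<theta> u = \<theta> w" using \<epsilon> by simp
    then show "u = w" using uw by (metis \<psi>_\<theta>)
  qed
  have "open (G 0 ` \<Omega>2)"
    using holomorphic_map_on_continuous[OF G_hol[OF V0]] opens(2) G0_inj by (rule invariance_of_domain)
  then obtain w0 where w0: "w0 \<in> \<Omega>2" and inj0: "inj (blinfun_apply (DG 0 w0))"
    using injective_derivative_if_open_image[OF DG[OF V0] _ nonempty(2)] by blast
  have linD: "linear (blinfun_apply D)" for D :: "(complex ^ 'm) \<Rightarrow>\<^sub>L (complex ^ 'm)"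
    by (simp add: linear_conv_bounded_linear blinfun.bounded_linear_right)
  obtain m where m: "m > 0" "\<And>h. m * norm h \<le> norm (DG 0 w0 h)"
    by (rule linear_inj_bounded_below_pos[OF linD inj0]) blast
  have DG_cont_v: "continuous_on V (\<lambda>v. DG v w0)"
    by (rule continuous_on_compose2[OF DG_cont, of V "\<lambda>v. (w0, v)", simplified])
       (use w0 in \<open>auto intro!: continuous_intros\<close>)
  then obtain \<eta> where \<eta>: "\<eta> > 0" "\<And>v. v \<in> V \<Longrightarrow> norm v < \<eta> \<Longrightarrow> norm (DG v w0 - DG 0 w0) < m / 2"
    using V0 m(1) unfolding continuous_on_iff dist_norm by (metis diff_zero half_gt_zero)
  obtain a b :: "complex ^ 'n" where K: "cbox a b \<subseteq> ball 0 (min \<eta> (\<rho> / 2))" and box0: "0 \<in> box a b"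
    using open_contains_cbox[OF open_ball, of 0 0 "min \<eta> (\<rho> / 2)"] \<eta> \<rho>
    by (metis centre_in_ball half_gt_zero min_less_iff_conj)
  have KV: "cbox a b \<subseteq> V" using K by (auto simp: V_def)
  obtain \<delta>' where "\<delta>' > 0" "ball 0 \<delta>' \<subseteq> box a b"
    using open_contains_ball[of "box a b"] box0 open_box by blast
  then obtain \<delta> where \<delta>: "\<delta> > 0" "ball 0 (2 * \<delta>) \<subseteq> cbox a b"
    using box_subset_cbox by (metis field_sum_of_halves half_gt_zero mult_2 subset_trans)
  obtain r where r: "r > 0" "ball w0 r \<subseteq> \<Omega>2"
    using opens(2) w0 open_contains_ball by blast
  define F where "F = (\<lambda>w. integral (cbox a b) (\<lambda>v. bump \<delta> v *\<^sub>R G v w))"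
  define DF where "DF = integral (cbox a b) (\<lambda>v. bump \<delta> v *\<^sub>R DG v w0)"
  have "(F has_derivative blinfun_apply DF) (at w0 within ball w0 r)"
    unfolding F_def DF_def
  proof (rule leibniz_rule[where fx = "\<lambda>w v. bump \<delta> v *\<^sub>R DG v w"])
    show "((\<lambda>w. bump \<delta> v *\<^sub>R G v w) has_derivative blinfun_apply (bump \<delta> v *\<^sub>R DG v w)) (at w within ball w0 r)"
      if "w \<in> ball w0 r" "v \<in> cbox a b" for w v
    proof -
      have "v \<in> V" "w \<in> \<Omega>2" using that r KV by auto
      from has_derivative_scaleR_right[OF has_derivative_at_withinI[OF DG[OF this]]]
      show ?thesis by (simp add: scaleR_blinfun.rep_eq)
    qed
    show "(\<lambda>v. bump \<delta> v *\<^sub>R G v w) integrable_on cbox a b" if "w \<in> ball w0 r" for w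
    proof -
      have "continuous_on (cbox a b) (\<lambda>v. G v w)"
        by (rule continuous_on_compose2[OF G_cont, of _ "\<lambda>v. (v, w)", simplified])
           (use that r KV in \<open>auto intro!: continuous_intros\<close>)
      then show ?thesis by (intro integrable_continuous continuous_intros)
    qed
    have "continuous_on (ball w0 r \<times> cbox a b) (\<lambda>x. DG (snd x) (fst x))"
      using DG_cont unfolding case_prod_beta by (rule continuous_on_subset) (use r KV in auto)
    then show "continuous_on (ball w0 r \<times> cbox a b) (\<lambda>(w, v). bump \<delta> v *\<^sub>R DG v w)"
      unfolding case_prod_beta by (intro continuous_intros)
  qed (use r in auto)
  then have F: "(F has_derivative blinfun_apply DF) (at w0)"
    using r by (simp add: at_within_open[OF _ open_ball])
  \<comment> \<open>If \<open>DF h = 0\<close>, the weighted average of the inner products of \<open>DG v w0 h\<close> with \<open>DG 0 w0 h\<close>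
    vanishes. They are nonnegative for all \<open>v\<close> in the box, so the one for \<open>v = 0\<close> is zero.\<close>
  have DF_inj: "inj (blinfun_apply DF)"
  proof -
    have "h = 0" if h: "blinfun_apply DF h = 0" for h
    proof -
      let ?A = "blinfun_apply (DG 0 w0) h"
      let ?q = "\<lambda>v. bump \<delta> v * (blinfun_apply (DG v w0) h \<bullet> ?A)"
      have cont: "continuous_on (cbox a b) (\<lambda>v. DG v w0)"
        using DG_cont_v KV by (rule continuous_on_subset)
      have "(\<lambda>v. bump \<delta> v *\<^sub>R DG v w0) integrable_on cbox a b"
        by (intro integrable_continuous continuous_intros cont)
      then have "((\<lambda>v. bump \<delta> v *\<^sub>R DG v w0) has_integral DF) (cbox a b)"
        unfolding DF_def by (rule integrable_integral)
      moreover have "bounded_linear (\<lambda>D. blinfun_apply D h \<bullet> ?A)"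
        by (intro bounded_linear_intros)
      ultimately have "((\<lambda>D. blinfun_apply D h \<bullet> ?A) \<circ> (\<lambda>v. bump \<delta> v *\<^sub>R DG v w0)
          has_integral blinfun_apply DF h \<bullet> ?A) (cbox a b)"
        by (rule has_integral_linear)
      then have "(?q has_integral 0) (cbox a b)"
        using h by (simp add: o_def scaleR_blinfun.rep_eq)
      moreover have "continuous_on (cbox a b) ?q"
        by (intro continuous_intros cont)
      moreover have "0 \<le> ?q v" if "v \<in> box a b" for v
      proof -
        have v: "v \<in> cbox a b" using that box_subset_cbox by blast
        have "norm (blinfun_apply (DG v w0 - DG 0 w0) h) \<le> norm (DG v w0 - DG 0 w0) * norm h"
          by (rule norm_blinfun)
        also have "\<dots> \<le> m / 2 * norm h"
        proof (rule mult_right_mono)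
          have "norm (DG v w0 - DG 0 w0) < m / 2"
            by (rule \<eta>(2)) (use v K KV in auto)
          then show "norm (DG v w0 - DG 0 w0) \<le> m / 2" by simp
        qed simp
        also have "\<dots> \<le> norm ?A" using m(2)[of h] norm_ge_zero[of ?A] by linarith
        finally have "norm (blinfun_apply (DG v w0 - DG 0 w0) h) * norm ?A \<le> norm ?A * norm ?A"
          by (intro mult_right_mono) auto
        then have "\<bar>blinfun_apply (DG v w0 - DG 0 w0) h \<bullet> ?A\<bar> \<le> norm ?A * norm ?A"
          using Cauchy_Schwarz_ineq2 order_trans by blast
        moreover have "blinfun_apply (DG v w0) h \<bullet> ?A
            = blinfun_apply (DG v w0 - DG 0 w0) h \<bullet> ?A + norm ?A * norm ?A"
          by (simp add: minus_blinfun.rep_eq inner_diff_left flip: power2_norm_eq_inner power2_eq_square)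
        ultimately have "0 \<le> blinfun_apply (DG v w0) h \<bullet> ?A" by linarith
        then show ?thesis by (simp add: bump_nonneg)
      qed
      ultimately have "?q 0 = 0"
        using has_integral_0_cbox_imp_0[of a b ?q 0] box0 box_subset_cbox by blast
      then have "?A = 0" using less_imp_neq[OF bump_zero_pos[OF \<delta>(1)]] by fastforce
      then show "h = 0" using m(1) m(2)[of h] by (simp add: mult_le_0_iff)
    qed
    then show ?thesis by (simp add: linear_injective_0[OF linD])
  qed
  define z0 where "z0 = \<theta> w0"
  have z0: "z0 \<in> \<Omega>1" and \<psi>z0: "\<psi> z0 = w0" using w0 by (simp_all add: z0_def \<theta>_in \<psi>_\<theta>)
  define k where "k = (\<lambda>v. \<psi> (p + v + \<epsilon> *\<^sub>R (z0 - p)))"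
  have k: "continuous_on (cbox a b) k"
    unfolding k_def
    by (rule continuous_on_compose2[OF continuous])
       (use into[OF _ z0] V KV in \<open>auto intro!: continuous_intros\<close>)
  define \<Phi> where "\<Phi> = (\<lambda>d. integral (cbox a b) (\<lambda>v. bump \<delta> (v - d) *\<^sub>R k v))"
  obtain \<Phi>' where "(\<Phi> has_derivative \<Phi>') (at (\<epsilon> *\<^sub>R (z0 - z0)))"
    using differentiable_integral_bump_translate[OF k] unfolding \<Phi>_def differentiable_def by blast
  moreover have "((\<lambda>z. \<epsilon> *\<^sub>R (z - z0)) has_derivative (\<lambda>h. \<epsilon> *\<^sub>R h)) (at z0)"
    by (auto intro!: derivative_eq_intros)
  ultimately have "((\<lambda>z. \<Phi> (\<epsilon> *\<^sub>R (z - z0))) has_derivative (\<lambda>h. \<Phi>' (\<epsilon> *\<^sub>R h))) (at z0)"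
    using has_derivative_compose[of "\<lambda>z. \<epsilon> *\<^sub>R (z - z0)"] by blast
  moreover have "open (\<Omega>1 \<inter> ball z0 (\<delta> / \<epsilon>))" "z0 \<in> \<Omega>1 \<inter> ball z0 (\<delta> / \<epsilon>)"
    using opens(1) z0 \<delta>(1) \<epsilon> by auto
  moreover have "\<Phi> (\<epsilon> *\<^sub>R (z - z0)) = F (\<psi> z)" if "z \<in> \<Omega>1 \<inter> ball z0 (\<delta> / \<epsilon>)" for z
  proof -
    have z: "z \<in> \<Omega>1" using that by simp
    have "\<epsilon> * norm (z - z0) < \<delta>"
      using that \<epsilon> by (simp add: dist_norm norm_minus_commute field_simps)
    then have "norm (\<epsilon> *\<^sub>R (z - z0)) < \<delta>"
      using \<epsilon> by (simp only: norm_scaleR abs_of_pos)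
    then have "\<Phi> (\<epsilon> *\<^sub>R (z - z0)) = integral (cbox a b) (\<lambda>v. bump \<delta> v *\<^sub>R k (v + \<epsilon> *\<^sub>R (z - z0)))"
      unfolding \<Phi>_def by (intro integral_bump_shift[OF \<delta> _ k, symmetric])
    moreover have "k (v + \<epsilon> *\<^sub>R (z - z0)) = G v (\<psi> z)" for v
      using z by (simp add: k_def G_def \<theta>_\<psi> algebra_simps)
    ultimately show ?thesis by (simp add: F_def)
  qed
  ultimately have "((\<lambda>z. F (\<psi> z)) has_derivative (\<lambda>h. \<Phi>' (\<epsilon> *\<^sub>R h))) (at z0)"
    by (rule has_derivative_transform_within_open)
  then have "(\<lambda>z. F (\<psi> z)) differentiable (at z0)"
    by (auto simp: differentiable_def)
  moreover have "isCont \<psi> z0"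
    using continuous opens(1) z0 by (simp add: continuous_on_eq_continuous_at)
  ultimately have "\<psi> differentiable (at z0)"
    using differentiable_cancel_left[of F "blinfun_apply DF" \<psi> z0] F DF_inj \<psi>z0 by simp
  then show ?thesis using z0 by blast
qed

lemma differentiable_everywhere:
  assumes "q \<in> \<Omega>1"
  shows "\<psi> differentiable (at q)"
proof -
  obtain p L where "p \<in> \<Omega>1" "(\<psi> has_derivative L) (at p)"
    using differentiable_somewhere unfolding differentiable_def by blast
  then show ?thesis
    using derivative_transport[OF _ assms] unfolding differentiable_def by metis
qed

lemma holomorphic_if_clinear_derivative:
  assumes "p \<in> \<Omega>1" "(\<psi> has_derivative L) (at p)" "Vector_Spaces.linear (*s) (*s) L"
  shows "holomorphic_map_on \<psi> \<Omega>1"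
  unfolding holomorphic_map_on_open[OF opens(1)]
proof
  fix q assume "q \<in> \<Omega>1"
  then obtain T and \<epsilon> :: real where "Vector_Spaces.linear (*s) (*s) T"
      and der: "(\<psi> has_derivative (\<lambda>h. T (L (\<epsilon> *\<^sub>R h)))) (at q)"
    using derivative_transport[OF assms(1) _ assms(2)] by metis
  then have "Vector_Spaces.linear (*s) (*s) (\<lambda>h. T (L (\<epsilon> *\<^sub>R h)))"
    using assms(3) by (simp add: clinear_iff scaleR_eq_smult vector_add_ldistrib vector_smult_assoc mult.commute)
  with der show "\<exists>L. Vector_Spaces.linear (*s) (*s) L \<and> (\<psi> has_derivative L) (at q)"
    by blast
qed

lemma antiholomorphic_if_conjugate_linear_derivative:
  assumes "p \<in> \<Omega>1" "(\<psi> has_derivative L) (at p)" "\<And>c x. L (c *s x) = cnj c *s L x"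
  shows "antiholomorphic_map_on \<psi> \<Omega>1"
  unfolding antiholomorphic_map_on_def holomorphic_map_on_open[OF opens(1)]
proof
  fix q assume "q \<in> \<Omega>1"
  then obtain T and \<epsilon> :: real where T: "Vector_Spaces.linear (*s) (*s) T"
      and der: "(\<psi> has_derivative (\<lambda>h. T (L (\<epsilon> *\<^sub>R h)))) (at q)"
    using derivative_transport[OF assms(1) _ assms(2)] by metis
  have cnj_linear: "bounded_linear (vec_cnj :: complex ^ 'm \<Rightarrow> complex ^ 'm)"
    by (simp add: vec_cnj_def linear_iff vec_eq_iff flip: linear_conv_bounded_linear)
  have "linear L" using assms(2) by (rule has_derivative_linear)
  then have add: "L (x + y) = L x + L y" for x y by (rule linear_add)
  have smult: "L (\<epsilon> *\<^sub>R (c *s x)) = cnj c *s L (\<epsilon> *\<^sub>R x)" for c x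
    using assms(3)[of c "\<epsilon> *\<^sub>R x"] by (simp add: scaleR_eq_smult vector_smult_assoc mult.commute)
  have "vec_cnj (v + w) = vec_cnj v + vec_cnj w" "vec_cnj (c *s v) = cnj c *s vec_cnj v"
    for c and v w :: "complex ^ 'm"
    by (simp_all add: vec_cnj_def vec_eq_iff)
  then have "Vector_Spaces.linear (*s) (*s) (\<lambda>h. vec_cnj (T (L (\<epsilon> *\<^sub>R h))))"
    using T by (simp add: clinear_iff smult add scaleR_right_distrib)
  moreover have "(vec_cnj \<circ> \<psi> has_derivative (\<lambda>h. vec_cnj (T (L (\<epsilon> *\<^sub>R h))))) (at q)"
    unfolding o_def by (rule bounded_linear.has_derivative[OF cnj_linear der])
  ultimately show "\<exists>L. Vector_Spaces.linear (*s) (*s) L \<and> (vec_cnj \<circ> \<psi> has_derivative L) (at q)"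
    by blast
qed

text \<open>
  The type of the derivative of \<open>\<psi>\<close> is decided at one point \<open>p\<close>; the derivative of \<open>\<theta>\<close> at \<open>\<psi> p\<close> is
  its inverse and has the same type, and both types spread to the whole domains.
\<close>

lemma holomorphic_or_antiholomorphic:
  "holomorphic_map_on \<psi> \<Omega>1 \<and> holomorphic_map_on \<theta> \<Omega>2 \<or>
   antiholomorphic_map_on \<psi> \<Omega>1 \<and> antiholomorphic_map_on \<theta> \<Omega>2"
proof -
  interpret inverse: endo_conjugation \<Omega>2 \<Omega>1 \<theta> \<psi> by (rule flip)
  obtain p where p: "p \<in> \<Omega>1" using nonempty by blast
  have q: "\<psi> p \<in> \<Omega>2" and \<theta>q: "\<theta> (\<psi> p) = p" using p by (simp_all add: \<psi>_in \<theta>_\<psi>)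
  obtain L where L: "(\<psi> has_derivative L) (at p)"
    using differentiable_everywhere[OF p] unfolding differentiable_def by blast
  obtain M where M: "(\<theta> has_derivative M) (at (\<psi> p))"
    using inverse.differentiable_everywhere[OF q] unfolding differentiable_def by blast
  have L': "(\<psi> has_derivative L) (at (\<theta> (\<psi> p)))" using L by (simp add: \<theta>q)
  have M_L: "M (L x) = x" for x by (rule derivatives_inverse[OF p L M])
  have L_M: "L (M y) = y" for y by (rule inverse.derivatives_inverse[OF q M L'])
  have lin: "linear L" "linear M" using L M by (simp_all add: has_derivative_linear)
  have "(\<forall>c x. L (c *s x) = c *s L x) \<or> (\<forall>c x. L (c *s x) = cnj c *s L x)"
    using lin M_L L_M conjugate_clinear[OF p L M] inverse.conjugate_clinear[OF q M L']
    by (rule clinear_or_conjugate_linear_if_conjugates_clinear)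
  then show ?thesis
  proof
    assume c: "\<forall>c x. L (c *s x) = c *s L x"
    then have "Vector_Spaces.linear (*s) (*s) L"
      using linear_add[OF lin(1)] by (simp add: clinear_iff)
    moreover have "M (c *s y) = c *s M y" for c y
      using c M_L L_M by metis
    then have "Vector_Spaces.linear (*s) (*s) M"
      using linear_add[OF lin(2)] by (simp add: clinear_iff)
    ultimately show ?thesis
      using holomorphic_if_clinear_derivative[OF p L] inverse.holomorphic_if_clinear_derivative[OF q M]
      by blast
  next
    assume c: "\<forall>c x. L (c *s x) = cnj c *s L x"
    have "M (c *s y) = cnj c *s M y" for c y
    proof -
      have "L (cnj c *s M y) = c *s y" using c L_M by simp
      then show ?thesis using M_L by metis
    qed
    then show ?thesis
      using c antiholomorphic_if_conjugate_linear_derivative[OF p L]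
        inverse.antiholomorphic_if_conjugate_linear_derivative[OF q M] by blast
  qed
qed

lemma dimensions_equal: "CARD('n) = CARD('m)"
proof -
  interpret inverse: endo_conjugation \<Omega>2 \<Omega>1 \<theta> \<psi> by (rule flip)
  have "DIM(complex ^ 'n) = DIM(complex ^ 'm)"
    using invariance_of_dimension[OF continuous opens(1) inj nonempty(1)]
      invariance_of_dimension[OF inverse.continuous opens(2) inverse.inj nonempty(2)]
    by (rule order_antisym)
  then show ?thesis by simp
qed

end

section \<open>Isomorphisms of the semigroups\<close>

lemma carrier_endo_semigroup:
  "f \<in> carrier (endo_semigroup \<Omega>) \<longleftrightarrow> f \<in> extensional \<Omega> \<and> hol_endo \<Omega> f"
  by (auto simp: endo_semigroup_def hol_endo_def PiE_def Pi_def image_subset_iff)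

lemma mult_endo_semigroup: "f \<otimes>\<^bsub>endo_semigroup \<Omega>\<^esub> g = compose \<Omega> f g"
  by (simp add: endo_semigroup_def)

lemma restrict_in_carrier:
  "hol_endo \<Omega> f \<Longrightarrow> restrict f \<Omega> \<in> carrier (endo_semigroup \<Omega>)"
  unfolding carrier_endo_semigroup by (auto elim: hol_endo_cong)

lemma constant_in_carrier:
  "a \<in> \<Omega> \<Longrightarrow> (\<lambda>z\<in>\<Omega>. a) \<in> carrier (endo_semigroup \<Omega>)"
  by (rule restrict_in_carrier)
     (auto simp: hol_endo_def holomorphic_map_on_def clinear_iff intro!: exI[of _ "\<lambda>_. 0"])

text \<open>Constants are characterised by multiplication alone, so isomorphisms preserve them.\<close>

lemma left_zero_iff_constant:
  assumes "\<Omega> \<noteq> {}" "f \<in> carrier (endo_semigroup \<Omega>)"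
  shows "(\<forall>g\<in>carrier (endo_semigroup \<Omega>). f \<otimes>\<^bsub>endo_semigroup \<Omega>\<^esub> g = f) \<longleftrightarrow>
    (\<exists>a\<in>\<Omega>. f = (\<lambda>z\<in>\<Omega>. a))"
proof
  assume zero: "\<forall>g\<in>carrier (endo_semigroup \<Omega>). f \<otimes>\<^bsub>endo_semigroup \<Omega>\<^esub> g = f"
  obtain b where b: "b \<in> \<Omega>" using assms(1) by blast
  have "f = compose \<Omega> f (\<lambda>z\<in>\<Omega>. b)"
    using zero constant_in_carrier[OF b] by (simp add: mult_endo_semigroup)
  also have "\<dots> = (\<lambda>z\<in>\<Omega>. f b)" by (auto simp: compose_def)
  finally have "f = (\<lambda>z\<in>\<Omega>. f b)" .
  moreover have "f b \<in> \<Omega>" using assms(2) b by (auto simp: carrier_endo_semigroup hol_endo_def)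
  ultimately show "\<exists>a\<in>\<Omega>. f = (\<lambda>z\<in>\<Omega>. a)" by blast
next
  assume "\<exists>a\<in>\<Omega>. f = (\<lambda>z\<in>\<Omega>. a)"
  then show "\<forall>g\<in>carrier (endo_semigroup \<Omega>). f \<otimes>\<^bsub>endo_semigroup \<Omega>\<^esub> g = f"
    by (auto simp: mult_endo_semigroup compose_def carrier_endo_semigroup hol_endo_def fun_eq_iff
        image_subset_iff)
qed

text \<open>
  Restricted to the constants, \<open>\<phi>\<close> is a bijection \<open>\<psi>\<close> of points. As the product of \<open>f\<close> with the
  constant \<open>a\<close> is the constant \<open>f a\<close>, applying \<open>\<phi>\<close> gives \<open>\<phi> f (\<psi> a) = \<psi> (f a)\<close>.
\<close>

lemma iso_endo_semigroup_is_conjugation: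
  assumes dom: "bounded_domain \<Omega>1" "bounded_domain \<Omega>2"
    and iso: "\<phi> \<in> iso (endo_semigroup \<Omega>1) (endo_semigroup \<Omega>2)"
  obtains \<psi> where "bij_betw \<psi> \<Omega>1 \<Omega>2" "endo_conjugation \<Omega>1 \<Omega>2 \<psi> (inv_into \<Omega>1 \<psi>)"
    "\<And>f. f \<in> carrier (endo_semigroup \<Omega>1) \<Longrightarrow> \<phi> f = restrict (\<psi> \<circ> f \<circ> inv_into \<Omega>1 \<psi>) \<Omega>2"
proof -
  let ?E1 = "endo_semigroup \<Omega>1" and ?E2 = "endo_semigroup \<Omega>2"
  have ne: "\<Omega>1 \<noteq> {}" "\<Omega>2 \<noteq> {}" using dom by (auto simp: bounded_domain_def)
  have hom: "\<phi> (f \<otimes>\<^bsub>?E1\<^esub> g) = \<phi> f \<otimes>\<^bsub>?E2\<^esub> \<phi> g" if "f \<in> carrier ?E1" "g \<in> carrier ?E1" for f g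
    using iso that by (auto simp: iso_def hom_def)
  have bij: "bij_betw \<phi> (carrier ?E1) (carrier ?E2)" using iso by (simp add: iso_def)
  have surj: "\<exists>f\<in>carrier ?E1. \<phi> f = g" if "g \<in> carrier ?E2" for g
    using that unfolding bij_betw_imp_surj_on[OF bij, symmetric] by blast
  have mult_constant: "f \<otimes>\<^bsub>?E1\<^esub> (\<lambda>z\<in>\<Omega>1. a) = (\<lambda>z\<in>\<Omega>1. f a)" if "a \<in> \<Omega>1" for f a
    using that by (auto simp: mult_endo_semigroup compose_def)
  have zero_iff: "(\<exists>b\<in>\<Omega>2. \<phi> f = (\<lambda>w\<in>\<Omega>2. b)) \<longleftrightarrow> (\<exists>a\<in>\<Omega>1. f = (\<lambda>z\<in>\<Omega>1. a))" if f: "f \<in> carrier ?E1" for f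
  proof -
    have mult: "f \<otimes>\<^bsub>?E1\<^esub> g \<in> carrier ?E1" if "g \<in> carrier ?E1" for g
      using hol_endo_compose[of \<Omega>1 f g] f that
      by (simp add: carrier_endo_semigroup mult_endo_semigroup) (metis (no_types) carrier_endo_semigroup compose_def restrict_in_carrier)
    have "(\<forall>g'\<in>carrier ?E2. \<phi> f \<otimes>\<^bsub>?E2\<^esub> g' = \<phi> f) \<longleftrightarrow> (\<forall>g\<in>carrier ?E1. \<phi> (f \<otimes>\<^bsub>?E1\<^esub> g) = \<phi> f)"
      unfolding bij_betw_imp_surj_on[OF bij, symmetric] by (simp add: hom f)
    also have "\<dots> \<longleftrightarrow> (\<forall>g\<in>carrier ?E1. f \<otimes>\<^bsub>?E1\<^esub> g = f)"
      using inj_on_eq_iff[OF bij_betw_imp_inj_on[OF bij] mult f] by simp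
    finally show ?thesis
      using left_zero_iff_constant[OF ne(1) f] left_zero_iff_constant[OF ne(2) bij_betwE[OF bij, rule_format, OF f]]
      by simp
  qed
  have "\<exists>b\<in>\<Omega>2. \<phi> (\<lambda>z\<in>\<Omega>1. a) = (\<lambda>w\<in>\<Omega>2. b)" if "a \<in> \<Omega>1" for a
    using zero_iff[OF constant_in_carrier[OF that]] that by blast
  then obtain \<psi> where \<psi>_in: "\<And>a. a \<in> \<Omega>1 \<Longrightarrow> \<psi> a \<in> \<Omega>2"
    and \<psi>: "\<And>a. a \<in> \<Omega>1 \<Longrightarrow> \<phi> (\<lambda>z\<in>\<Omega>1. a) = (\<lambda>w\<in>\<Omega>2. \<psi> a)" by metis
  have constant_eq: "a = b" if "(\<lambda>z\<in>S. a) = (\<lambda>z\<in>S. b)" "S \<noteq> {}" for a b :: 'c and S :: "'d set"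
    using that by (metis ex_in_conv restrict_apply')
  have bij_\<psi>: "bij_betw \<psi> \<Omega>1 \<Omega>2"
  proof (rule bij_betwI')
    fix a b assume ab: "a \<in> \<Omega>1" "b \<in> \<Omega>1"
    show "\<psi> a = \<psi> b \<longleftrightarrow> a = b"
    proof
      assume "\<psi> a = \<psi> b"
      then have "\<phi> (\<lambda>z\<in>\<Omega>1. a) = \<phi> (\<lambda>z\<in>\<Omega>1. b)" using \<psi> ab by simp
      then have "(\<lambda>z\<in>\<Omega>1. a) = (\<lambda>z\<in>\<Omega>1. b)"
        by (rule inj_onD[OF bij_betw_imp_inj_on[OF bij]]) (simp_all add: constant_in_carrier ab)
      then show "a = b" by (rule constant_eq[OF _ ne(1)])
    qed simp
  next
    show "\<psi> a \<in> \<Omega>2" if "a \<in> \<Omega>1" for a using that by (rule \<psi>_in)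
  next
    fix b assume b: "b \<in> \<Omega>2"
    obtain f where f: "f \<in> carrier ?E1" "\<phi> f = (\<lambda>w\<in>\<Omega>2. b)"
      using surj[OF constant_in_carrier[OF b]] by blast
    then obtain a where a: "a \<in> \<Omega>1" "f = (\<lambda>z\<in>\<Omega>1. a)"
      using zero_iff[OF f(1)] b by blast
    then have "(\<lambda>w\<in>\<Omega>2. b) = (\<lambda>w\<in>\<Omega>2. \<psi> a)" using \<psi> f by simp
    then have "b = \<psi> a" by (rule constant_eq[OF _ ne(2)])
    then show "\<exists>a\<in>\<Omega>1. b = \<psi> a" using a by blast
  qed
  let ?\<theta> = "inv_into \<Omega>1 \<psi>"
  have \<theta>: "?\<theta> w \<in> \<Omega>1" "\<psi> (?\<theta> w) = w" if "w \<in> \<Omega>2" for w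
    using bij_\<psi> that by (auto simp: bij_betw_def f_inv_into_f inv_into_into)
  have \<theta>': "?\<theta> (\<psi> z) = z" if "z \<in> \<Omega>1" for z
    using bij_\<psi> that by (simp add: bij_betw_def)
  have image: "\<phi> f (\<psi> a) = \<psi> (f a)" if f: "f \<in> carrier ?E1" and a: "a \<in> \<Omega>1" for f a
  proof -
    have fa: "f a \<in> \<Omega>1" using f a by (auto simp: carrier_endo_semigroup hol_endo_def)
    have "(\<lambda>w\<in>\<Omega>2. \<psi> (f a)) = \<phi> (f \<otimes>\<^bsub>?E1\<^esub> (\<lambda>z\<in>\<Omega>1. a))"
      using \<psi>[OF fa] mult_constant[OF a] by simp
    also have "\<dots> = \<phi> f \<otimes>\<^bsub>?E2\<^esub> (\<lambda>w\<in>\<Omega>2. \<psi> a)"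
      using hom[OF f constant_in_carrier[OF a]] \<psi>[OF a] by simp
    also have "\<dots> = (\<lambda>w\<in>\<Omega>2. \<phi> f (\<psi> a))"
      by (auto simp: mult_endo_semigroup compose_def)
    finally have "(\<lambda>w\<in>\<Omega>2. \<psi> (f a)) = (\<lambda>w\<in>\<Omega>2. \<phi> f (\<psi> a))" .
    from constant_eq[OF this ne(2)] show ?thesis by simp
  qed
  have \<phi>_eq: "\<phi> f = restrict (\<psi> \<circ> f \<circ> ?\<theta>) \<Omega>2" if f: "f \<in> carrier ?E1" for f
  proof -
    have "\<phi> f \<in> extensional \<Omega>2"
      using bij_betwE[OF bij] f by (simp add: carrier_endo_semigroup)
    moreover have "\<phi> f w = \<psi> (f (?\<theta> w))" if "w \<in> \<Omega>2" for w
      using image[OF f \<theta>(1)[OF that]] \<theta>(2)[OF that] by simp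
    ultimately show ?thesis by (auto intro!: extensionalityI[where A = \<Omega>2])
  qed
  have "endo_conjugation \<Omega>1 \<Omega>2 \<psi> ?\<theta>"
  proof
    show "hol_endo \<Omega>2 (\<lambda>w. \<psi> (f (?\<theta> w)))" if f: "hol_endo \<Omega>1 f" for f
    proof (rule hol_endo_cong)
      show "hol_endo \<Omega>2 (\<phi> (restrict f \<Omega>1))"
        using bij_betwE[OF bij] restrict_in_carrier[OF f] by (simp add: carrier_endo_semigroup)
      show "\<psi> (f (?\<theta> w)) = \<phi> (restrict f \<Omega>1) w" if "w \<in> \<Omega>2" for w
        using \<phi>_eq[OF restrict_in_carrier[OF f]] \<theta> that by simp
    qed
    show "hol_endo \<Omega>1 (\<lambda>z. ?\<theta> (g (\<psi> z)))" if g: "hol_endo \<Omega>2 g" for g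
    proof -
      obtain f where f: "f \<in> carrier ?E1" "\<phi> f = restrict g \<Omega>2"
        using surj[OF restrict_in_carrier[OF g]] by blast
      have "?\<theta> (g (\<psi> z)) = f z" if z: "z \<in> \<Omega>1" for z
      proof -
        have "g (\<psi> z) = \<psi> (f z)" using image[OF f(1) z] f(2) \<psi>_in[OF z] by simp
        moreover have "f z \<in> \<Omega>1" using f(1) z by (auto simp: carrier_endo_semigroup hol_endo_def)
        ultimately show ?thesis by (simp add: \<theta>')
      qed
      moreover have "hol_endo \<Omega>1 f" using f(1) by (simp add: carrier_endo_semigroup)
      ultimately show ?thesis by (rule hol_endo_cong[rotated])
    qed
  qed (fact dom \<psi>_in \<theta> \<theta>' | assumption)+
  then show thesis by (rule that[OF bij_\<psi> _ \<phi>_eq])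
qed

theorem theorem1:
  fixes \<Omega>1 :: "(complex ^ 'n) set" and \<Omega>2 :: "(complex ^ 'm) set"
    and \<phi> :: "(complex ^ 'n \<Rightarrow> complex ^ 'n) \<Rightarrow> (complex ^ 'm \<Rightarrow> complex ^ 'm)"
  assumes "bounded_domain \<Omega>1" and "bounded_domain \<Omega>2"
    and "\<phi> \<in> iso (endo_semigroup \<Omega>1) (endo_semigroup \<Omega>2)"
  shows "CARD('n) = CARD('m) \<and>
    (\<exists>\<psi>. (biholomorphic_map \<Omega>1 \<Omega>2 \<psi> \<or> antibiholomorphic_map \<Omega>1 \<Omega>2 \<psi>) \<and>
         (\<forall>f \<in> carrier (endo_semigroup \<Omega>1).
            \<phi> f = restrict (\<psi> \<circ> f \<circ> inv_into \<Omega>1 \<psi>) \<Omega>2))"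
proof -
  obtain \<psi> where \<psi>: "bij_betw \<psi> \<Omega>1 \<Omega>2"
    and conj: "endo_conjugation \<Omega>1 \<Omega>2 \<psi> (inv_into \<Omega>1 \<psi>)"
    and \<phi>: "\<And>f. f \<in> carrier (endo_semigroup \<Omega>1) \<Longrightarrow> \<phi> f = restrict (\<psi> \<circ> f \<circ> inv_into \<Omega>1 \<psi>) \<Omega>2"
    by (rule iso_endo_semigroup_is_conjugation[OF assms]) blast
  interpret endo_conjugation \<Omega>1 \<Omega>2 \<psi> "inv_into \<Omega>1 \<psi>" by (rule conj)
  have "biholomorphic_map \<Omega>1 \<Omega>2 \<psi> \<or> antibiholomorphic_map \<Omega>1 \<Omega>2 \<psi>"
    using \<psi> holomorphic_or_antiholomorphic
    by (auto simp: biholomorphic_map_def antibiholomorphic_map_def)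
  then show ?thesis using dimensions_equal \<phi> by blast
qed

end
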